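(* Consider the problem of minimizing $f(x)$ subject to $Ax=b$, $x\in P$, where $f$ is differentiable (not necessarily convex), $A\in\mathbb{R}^{m\times n}$, $b\in\mathbb{R}^m$, and $P=\{x\in\mathbb{R}^n: \ell_i\le x_i\le u_i,\ i=1,\dots,n\}$ is a bounded box with $\ell_i<u_i$ for all $i$. Suppose that: (a) the origin is in the relative interior of $\{Ax-b: x\in P\}$; (b) the strict complementarity condition holds for the problem; (c) $\|\nabla f(x)-\nabla f(x')\|\le L\|x-x'\|$ for all $x,x'\in P$, for some $L>0$. Moreover, suppose the parameters $c$ and $p$ are selected to satisfy $0<c<1/L_K$ and $p>-\gamma$, and that the primal and dual stepsizes $\beta$ and $\alpha$ are sufficiently small. Then the dual iterates $\{y^t\}$ generated by the proximal inexact augmented Lagrangian multiplier method are bounded. Moreover, $$\lim_{t\to\infty}\|x^{t+1}-x^t\|=0,\quad \lim_{t\to\infty}\mathrm{dist}(x^t,X^* )=0,\quad \lim_{t\to\infty}\mathrm{dist}(z^t,X^* )=0,\quad \lim_{t\to\infty}\mathrm{dist}((x^t,y^t),W)=0,$$ and every limit point of the sequence $\{(x^t,y^t)\}$ generated by the method is a primal-dual stationary point of the problem.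
   Context: $\|\cdot\|$ is the Euclidean norm, $\mathrm{dist}$ is Euclidean distance to a set, and $[\cdot]_+$ is the Euclidean projection onto $P$. $\gamma$ is a constant (possibly negative) such that $\langle\nabla f(x)-\nabla f(x'),x-x'\rangle\ge\gamma\|x-x'\|^2$ for all $x,x'\in P$; it exists by (c). $\Gamma>0$ and $p>0$ are parameters, and $L_K=L+p+\Gamma\sigma^2$ with $\sigma$ the spectral norm of $A$. KKT system of the problem: $(x,y,\mu,\nu)\in\mathbb{R}^n\times\mathbb{R}^m\times\mathbb{R}^n\times\mathbb{R}^n$ satisfies $\nabla f(x)+A^Ty-\mu+\nu=0$, $Ax=b$, $\ell_i\le x_i\le u_i$, $\mu_i\ge0$, $\nu_i\ge 0$, $\mu_i(\ell_i-x_i)=0$, $\nu_i(x_i-u_i)=0$ for all $i$. $X^*$ is the set of all $x$ that occur in a solution of the KKT system (stationary points), and $W$ is the set of primal-dual stationary points, i.e. pairs $(x,y)$ for which there exist $\mu,\nu$ such that $(x,y,\mu,\nu)$ solves the KKT system. Strict complementarity condition: for every solution $(x,y,\mu,\nu)$ of the KKT system and every $i$, exactly one of $\mu_i$ and $\ell_i-x_i$ is zero, and exactly one of $\nu_i$ and $x_i-u_i$ is zero. Let $K(x,z;y)=f(x)+y^T(Ax-b)+\frac{\Gamma}{2}\|Ax-b\|^2+\frac p2\|x-z\|^2$. Proximal inexact augmented Lagrangian multiplier method (parameters $\Gamma>0$, $\alpha>0$, $0<\beta\le1$, $0<c<1/L_K$): start from $x^0\in P$, $z^0\in P$, $y^0\in\mathbb{R}^m$;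 for $t=0,1,2,\dots$ set $y^{t+1}=y^t+\alpha(Ax^t-b)$, $x^{t+1}=[x^t-c\nabla_xK(x^t,z^t;y^{t+1})]_+$, $z^{t+1}=z^t+\beta(x^{t+1}-z^t)$. *)

theory Defs
  imports "HOL-Analysis.Analysis"
begin

text \<open>
  The problem is to minimise \<open>f x\<close> subject to \<open>A *v x = b\<close> and \<open>x \<in> cbox l u\<close>, where
  \<open>A :: real^'n^'m\<close> has \<open>m = CARD('m)\<close> rows and \<open>n = CARD('n)\<close> columns.  On \<open>real^'n\<close>,
  \<open>cbox l u\<close> is the coordinatewise box (\<open>mem_box_cart\<close>).
\<close>

text \<open>Only meaningful at points where \<open>f\<close> is differentiable; otherwise an unspecified value.\<close>

definition gradient :: "('a::euclidean_space \<Rightarrow> real) \<Rightarrow> 'a \<Rightarrow> 'a" where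
  "gradient f x = (THE D. GDERIV f x :> D)"

lemma gradient_eqI:
  assumes "GDERIV f x :> D"
  shows "gradient f x = D"
  unfolding gradient_def
proof (rule the_equality)
  fix D' assume "GDERIV f x :> D'"
  then have "(\<lambda>h. h \<bullet> D') = (\<lambda>h. h \<bullet> D)"
    using assms unfolding gderiv_def by (rule has_derivative_unique)
  then have "(D' - D) \<bullet> D' = (D' - D) \<bullet> D"
    by (rule fun_cong)
  then have "(D' - D) \<bullet> (D' - D) = 0"
    by (simp add: inner_diff_right)
  then show "D' = D"
    by simp
qed (fact assms)

definition kkt :: "(real^'n \<Rightarrow> real) \<Rightarrow> real^'n^'m \<Rightarrow> real^'m \<Rightarrow> real^'n \<Rightarrow> real^'n
    \<Rightarrow> real^'n \<Rightarrow> real^'m \<Rightarrow> real^'n \<Rightarrow> real^'n \<Rightarrow> bool" where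
  "kkt f A b l u x y \<mu> \<nu> \<longleftrightarrow>
     gradient f x + transpose A *v y - \<mu> + \<nu> = 0 \<and>
     A *v x = b \<and>
     (\<forall>i. l $ i \<le> x $ i \<and> x $ i \<le> u $ i \<and> \<mu> $ i \<ge> 0 \<and> \<nu> $ i \<ge> 0 \<and>
          \<mu> $ i * (l $ i - x $ i) = 0 \<and> \<nu> $ i * (x $ i - u $ i) = 0)"

definition stationary_points ::
  "(real^'n \<Rightarrow> real) \<Rightarrow> real^'n^'m \<Rightarrow> real^'m \<Rightarrow> real^'n \<Rightarrow> real^'n \<Rightarrow> (real^'n) set" where
  "stationary_points f A b l u = {x. \<exists>y \<mu> \<nu>. kkt f A b l u x y \<mu> \<nu>}"

definition primal_dual_stationary_points ::
  "(real^'n \<Rightarrow> real) \<Rightarrow> real^'n^'m \<Rightarrow> real^'m \<Rightarrow> real^'n \<Rightarrow> real^'n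
    \<Rightarrow> ((real^'n) \<times> (real^'m)) set" where
  "primal_dual_stationary_points f A b l u = {(x, y). \<exists>\<mu> \<nu>. kkt f A b l u x y \<mu> \<nu>}"

text \<open>The inequality between truth values is exclusive or: exactly one of the two quantities
  vanishes.\<close>

definition strict_complementarity ::
  "(real^'n \<Rightarrow> real) \<Rightarrow> real^'n^'m \<Rightarrow> real^'m \<Rightarrow> real^'n \<Rightarrow> real^'n \<Rightarrow> bool" where
  "strict_complementarity f A b l u \<longleftrightarrow>
     (\<forall>x y \<mu> \<nu>. kkt f A b l u x y \<mu> \<nu> \<longrightarrow>
        (\<forall>i. (\<mu> $ i = 0) \<noteq> (l $ i - x $ i = 0) \<and> (\<nu> $ i = 0) \<noteq> (x $ i - u $ i = 0)))"

definition prox_aug_lagrangian :: "(real^'n \<Rightarrow> real) \<Rightarrow> real^'n^'m \<Rightarrow> real^'m \<Rightarrow> real \<Rightarrow> real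
    \<Rightarrow> real^'n \<Rightarrow> real^'n \<Rightarrow> real^'m \<Rightarrow> real" where
  "prox_aug_lagrangian f A b \<Gamma> p x z y =
     f x + y \<bullet> (A *v x - b) + \<Gamma> / 2 * (norm (A *v x - b))\<^sup>2 + p / 2 * (norm (x - z))\<^sup>2"

text \<open>\<open>closest_point (cbox l u)\<close> is the Euclidean projection onto the box.\<close>

definition prox_inexact_ALM :: "(real^'n \<Rightarrow> real) \<Rightarrow> real^'n^'m \<Rightarrow> real^'m \<Rightarrow> real^'n \<Rightarrow> real^'n
    \<Rightarrow> real \<Rightarrow> real \<Rightarrow> real \<Rightarrow> real \<Rightarrow> real
    \<Rightarrow> (nat \<Rightarrow> real^'n) \<Rightarrow> (nat \<Rightarrow> real^'m) \<Rightarrow> (nat \<Rightarrow> real^'n) \<Rightarrow> bool" where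
  "prox_inexact_ALM f A b l u \<Gamma> p c \<alpha> \<beta> x y z \<longleftrightarrow>
     x 0 \<in> cbox l u \<and> z 0 \<in> cbox l u \<and>
     (\<forall>t. y (Suc t) = y t + \<alpha> *\<^sub>R (A *v x t - b) \<and>
          x (Suc t) = closest_point (cbox l u)
            (x t - c *\<^sub>R gradient (\<lambda>\<xi>. prox_aug_lagrangian f A b \<Gamma> p \<xi> (z t) (y (Suc t))) (x t)) \<and>
          z (Suc t) = z t + \<beta> *\<^sub>R (x (Suc t) - z t))"

end

theory Submission
  imports Defs
begin

text \<open>
  With \<open>d(y, z) = min K(\<cdot>, z; y)\<close> over the box, attained at \<open>x(y, z)\<close>, and \<open>M(z)\<close> the minimum of
  \<open>K(\<cdot>, z; 0)\<close> over the feasible set, attained at \<open>x\<^sup>*(z)\<close>, the potential \<open>K - 2d + 2M\<close>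
  decreases along the iteration by a multiple of the squared primal, dual and proximal steps.
  The only term of unfavourable sign is controlled by the global error bound
  \<open>\<parallel>x(y, z) - x\<^sup>*(z)\<parallel> \<le> C \<parallel>A x(y, z) - b\<parallel>\<close>: as the right-hand side of \<open>Ax = b\<close> moves along a
  segment, the minimizer is Lipschitz while a fixed face of the box certifies its optimality,
  and finitely many faces suffice. All constants are independent of the starting point, so all
  steps and the residual tend to zero; the interior point condition then bounds the
  multipliers, and passing to the limit in the projection inequality gives the KKT system.
\<close>

subsection \<open>Variational inequalities on slices of a box\<close>

text \<open>No bound on the multipliers is at hand before the steps are known to vanish, so every
  estimate behind the descent must be uniform in \<open>y\<close>. The error bound is uniform
  because \<open>y\<close> shifts the gradient of \<open>K\<close> by \<open>y v* A\<close>, which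
  is orthogonal to the kernel of \<open>A\<close>: on a slice of the box with \<open>A x\<close>
  fixed the multiplier is invisible, and \<open>xmin z y\<close> and \<open>xfeas z\<close> solve
  one variational inequality on two slices. Optimality is therefore tested on directions and never
  expressed by multipliers of the slice constraint. With r the residual at the iterate and r' the
  one at the box minimizer, the weight 2 on d turns the growth of \<open>K\<close> in the multiplier
  step into \<alpha> |r - r'|^2 - \<alpha> |r'|^2. The same weight on M offsets the change of d
  under a moving prox center, up to an inner product of the center step with a difference between a
  box minimizer and a feasible minimizer. This fixes the order of choice: the primal step bounds
  \<alpha>, and then \<alpha> bounds \<beta>.\<close>

text \<open>On the orthogonal complement, within \<open>S\<close>, of the kernel of \<open>A\<close>
  in \<open>S\<close>, the matrix is injective and hence bounded below; \<open>n\<close> is the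
  kernel component of \<open>w\<close>.\<close>

lemma matrix_bounded_below_mod_kernel:
  fixes A :: "real^'n^'m" and S :: "(real^'n) set"
  assumes "subspace S"
  obtains C where "0 < C"
    and "\<And>w. w \<in> S \<Longrightarrow> \<exists>n\<in>S. A *v n = 0 \<and> norm (w - n) \<le> C * norm (A *v w)"
proof -
  define N where "N = S \<inter> {n. A *v n = 0}"
  define W where "W = S \<inter> {w. \<forall>n\<in>N. n \<bullet> w = 0}"
  have N: "subspace N"
    unfolding N_def using assms
    by (intro subspace_inter) (auto simp: subspace_def algebra_simps)
  have W: "subspace W"
    unfolding W_def using assms
    by (intro subspace_inter) (auto simp: subspace_def inner_add_right)
  have "x = 0" if "x \<in> W" "A *v x = 0" for x
  proof -
    have "x \<in> N" using that by (auto simp: W_def N_def)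
    then have "x \<bullet> x = 0" using that by (auto simp: W_def)
    then show ?thesis by simp
  qed
  then obtain e where e: "e > 0" "\<forall>x\<in>W. norm (A *v x) \<ge> e * norm x"
    using injective_imp_isometric[OF closed_subspace[OF W] W, of "(*v) A"]
      matrix_vector_mul_bounded_linear by blast
  show ?thesis
  proof
    show "0 < 1 / e" using e by simp
    fix w assume w: "w \<in> S"
    obtain n v where nv: "n \<in> span N" "\<And>k. k \<in> span N \<Longrightarrow> orthogonal v k" "w = n + v"
      by (rule orthogonal_subspace_decomp_exists[of N w]) blast
    have n: "n \<in> N" using nv N by (simp add: span_eq_iff[THEN iffD2])
    have "v \<in> S" using nv(3) w n assms by (auto simp: N_def dest: subspace_diff[of S w n])
    then have "v \<in> W"
      using nv(2) N by (auto simp: W_def orthogonal_def inner_commute span_eq_iff[THEN iffD2])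
    moreover have "A *v v = A *v w" using nv(3) n by (simp add: N_def matrix_vector_right_distrib)
    ultimately have "e * norm v \<le> norm (A *v w)" using e by metis
    then have "norm (w - n) \<le> 1 / e * norm (A *v w)"
      using e nv(3) by (simp add: field_simps)
    with n show "\<exists>n\<in>S. A *v n = 0 \<and> norm (w - n) \<le> 1 / e * norm (A *v w)"
      by (auto simp: N_def)
  qed
qed

text \<open>The slice is named by a point \<open>q\<close> instead of a right-hand side: it is
  nonempty for \<open>q\<close> in the box, and taking \<open>q = x\<close> says that
  \<open>x\<close> solves the inequality on its own slice.\<close>

definition vi_sol :: "(real^'n \<Rightarrow> real^'n) \<Rightarrow> real^'n^'m \<Rightarrow> real^'n \<Rightarrow> real^'n
    \<Rightarrow> real^'n \<Rightarrow> real^'n \<Rightarrow> bool" where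
  "vi_sol G A l u q x \<longleftrightarrow> x \<in> cbox l u \<and> A *v x = A *v q \<and>
     (\<forall>x'\<in>cbox l u. A *v x' = A *v q \<longrightarrow> 0 \<le> G x \<bullet> (x' - x))"

text \<open>Solutions certified by the face \<open>(I, I')\<close> of the box; being a certificate is a
  closed condition, whereas having \<open>(I, I')\<close> as the exact active set is not.\<close>

definition face_sol :: "(real^'n \<Rightarrow> real^'n) \<Rightarrow> real^'n^'m \<Rightarrow> real^'n \<Rightarrow> real^'n
    \<Rightarrow> 'n set \<times> 'n set \<Rightarrow> real^'n \<Rightarrow> bool" where
  "face_sol G A l u J x \<longleftrightarrow> (\<forall>i\<in>fst J. x $ i = l $ i) \<and> (\<forall>i\<in>snd J. x $ i = u $ i) \<and>
     (\<forall>d. A *v d = 0 \<and> (\<forall>i\<in>fst J. 0 \<le> d $ i) \<and> (\<forall>i\<in>snd J. d $ i \<le> 0) \<longrightarrow> 0 \<le> G x \<bullet> d)"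

lemma vi_sol_unique:
  assumes "vi_sol G A l u q x" "vi_sol G A l u q x'" "0 < m"
    and "m * (norm (x - x'))\<^sup>2 \<le> (G x - G x') \<bullet> (x - x')"
  shows "x = x'"
proof -
  have "0 \<le> G x \<bullet> (x' - x)" "0 \<le> G x' \<bullet> (x - x')"
    using assms(1,2) by (auto simp: vi_sol_def)
  then have "(G x - G x') \<bullet> (x - x') \<le> 0"
    by (simp add: inner_diff_left inner_diff_right)
  then have "m * (norm (x - x'))\<^sup>2 \<le> 0" using assms(4) by linarith
  with assms(3) show ?thesis by (simp add: mult_le_0_iff)
qed

lemma face_sol_imp_vi_sol:
  assumes "face_sol G A l u J x" "x \<in> cbox l u" "A *v x = A *v q"
  shows "vi_sol G A l u q x"
  unfolding vi_sol_def
proof (intro conjI ballI impI assms)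
  fix x' assume "x' \<in> cbox l u" "A *v x' = A *v q"
  then show "0 \<le> G x \<bullet> (x' - x)"
    using assms unfolding face_sol_def
    by (auto simp: mem_box_cart matrix_vector_mult_diff_distrib)
qed

text \<open>For the exact active set, an admissible direction leaves no active bound in the wrong
  sense, and inactive bounds have slack; finitely many coordinates share one positive step
  \<open>s\<close>, and the inequality is tested at \<open>x + s *\<^sub>R d\<close>.\<close>

lemma vi_sol_imp_face_sol:
  fixes l u x :: "real^'n"
  assumes box: "\<And>i. l $ i < u $ i" and sol: "vi_sol G A l u q x"
  shows "face_sol G A l u ({i. x $ i = l $ i}, {i. x $ i = u $ i}) x"
  unfolding face_sol_def
proof (intro conjI allI impI)
  fix d assume d: "A *v d = 0 \<and> (\<forall>i\<in>fst ({i. x $ i = l $ i}, {i. x $ i = u $ i}). 0 \<le> d $ i) \<and>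
    (\<forall>i\<in>snd ({i. x $ i = l $ i}, {i. x $ i = u $ i}). d $ i \<le> 0)"
  have x: "l $ i \<le> x $ i" "x $ i \<le> u $ i" for i
    using sol by (auto simp: vi_sol_def mem_box_cart)
  have ex: "eventually (\<lambda>s. l $ i \<le> x $ i + s * d $ i \<and> x $ i + s * d $ i \<le> u $ i)
      (at_right (0::real))" for i
  proof -
    have lim: "((\<lambda>s. x $ i + s * d $ i) \<longlongrightarrow> x $ i + 0 * d $ i) (at_right (0::real))"
      by (intro tendsto_intros)
    have pos: "eventually (\<lambda>s. (0::real) < s) (at_right 0)"
      by (simp add: eventually_at_right_less)
    have "eventually (\<lambda>s. l $ i \<le> x $ i + s * d $ i) (at_right (0::real))"
    proof (cases "x $ i = l $ i")
      case True
      then have "0 \<le> d $ i" using d by auto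
      with True show ?thesis using pos by (auto elim!: eventually_mono)
    next
      case False
      then have "l $ i < x $ i + 0 * d $ i" using x[of i] by simp
      from order_tendstoD(1)[OF lim this] show ?thesis by (auto elim!: eventually_mono)
    qed
    moreover have "eventually (\<lambda>s. x $ i + s * d $ i \<le> u $ i) (at_right (0::real))"
    proof (cases "x $ i = u $ i")
      case True
      then have "d $ i \<le> 0" using d by auto
      with True show ?thesis
        using pos by (auto elim!: eventually_mono simp: mult_nonneg_nonpos)
    next
      case False
      then have "x $ i + 0 * d $ i < u $ i" using x[of i] by simp
      from order_tendstoD(2)[OF lim this] show ?thesis by (auto elim!: eventually_mono)
    qed
    ultimately show ?thesis by (rule eventually_conj)
  qed
  have "eventually (\<lambda>s. \<forall>i. l $ i \<le> x $ i + s * d $ i \<and> x $ i + s * d $ i \<le> u $ i)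
      (at_right (0::real))"
    using ex by (intro eventually_all_finite) auto
  moreover have "eventually (\<lambda>s. (0::real) < s) (at_right 0)"
    by (simp add: eventually_at_right_less)
  ultimately have "eventually (\<lambda>s. 0 < s \<and> (\<forall>i. l $ i \<le> x $ i + s * d $ i \<and>
      x $ i + s * d $ i \<le> u $ i)) (at_right (0::real))"
    by eventually_elim auto
  then have "\<exists>s::real. 0 < s \<and> (\<forall>i. l $ i \<le> x $ i + s * d $ i \<and> x $ i + s * d $ i \<le> u $ i)"
    by (rule eventually_happens'[rotated]) simp
  then obtain s :: real where s: "0 < s" "x + s *\<^sub>R d \<in> cbox l u"
    by (auto simp: mem_box_cart)
  moreover have "A *v (x + s *\<^sub>R d) = A *v q"
    using sol d by (simp add: vi_sol_def matrix_vector_right_distrib matrix_vector_mult_scaleR)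
  ultimately have "0 \<le> G x \<bullet> (x + s *\<^sub>R d - x)"
    using sol unfolding vi_sol_def by blast
  with s(1) show "0 \<le> G x \<bullet> d" by (simp add: zero_le_mult_iff)
qed auto

text \<open>On a common face, \<open>x - x'\<close> vanishes in the coordinates of \<open>J\<close>.
  Its kernel part \<open>n\<close> is admissible with both signs, so \<open>G x\<close> and
  \<open>G x'\<close> are orthogonal to it, and strong monotonicity is paid for by the remaining
  part, which \<open>A\<close> controls. The constant is fixed before \<open>G\<close>, as
  \<open>G\<close> will vary with the prox center.\<close>

lemma face_sol_dist_bound:
  fixes A :: "real^'n^'m" and l u :: "real^'n"
  assumes m: "0 < m" and \<Lambda>: "0 < \<Lambda>"
  obtains C where "0 < C"
    and "\<And>G x x'. \<lbrakk>face_sol G A l u J x; face_sol G A l u J x';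
      norm (G x - G x') \<le> \<Lambda> * norm (x - x');
      m * (norm (x - x'))\<^sup>2 \<le> (G x - G x') \<bullet> (x - x')\<rbrakk>
      \<Longrightarrow> norm (x - x') \<le> C * norm (A *v x - A *v x')"
proof -
  define S :: "(real^'n) set" where "S = {w. \<forall>i\<in>fst J \<union> snd J. w $ i = 0}"
  have "subspace S" by (auto simp: S_def subspace_def)
  then obtain C where C: "0 < C"
    "\<And>w. w \<in> S \<Longrightarrow> \<exists>n\<in>S. A *v n = 0 \<and> norm (w - n) \<le> C * norm (A *v w)"
    by (rule matrix_bounded_below_mod_kernel[of _ A]) blast
  show ?thesis
  proof
    show "0 < \<Lambda> * C / m" using m \<Lambda> C by simp
    fix G x x'
    assume x: "face_sol G A l u J x" and x': "face_sol G A l u J x'"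
      and lip: "norm (G x - G x') \<le> \<Lambda> * norm (x - x')"
      and mono: "m * (norm (x - x'))\<^sup>2 \<le> (G x - G x') \<bullet> (x - x')"
    have "x - x' \<in> S" using x x' by (auto simp: S_def face_sol_def)
    then obtain n where n: "n \<in> S" "A *v n = 0"
        "norm (x - x' - n) \<le> C * norm (A *v x - A *v x')"
      using C(2) by (metis matrix_vector_mult_diff_distrib)
    have zero: "G w \<bullet> n = 0" if "face_sol G A l u J w" for w
    proof -
      have "0 \<le> G w \<bullet> n" "0 \<le> G w \<bullet> (- n)"
        using that n matrix_vector_mult_diff_distrib[of A 0 n] unfolding face_sol_def S_def
        by (auto simp del: inner_minus_right)
      then show ?thesis by simp
    qed
    have "m * (norm (x - x'))\<^sup>2 \<le> (G x - G x') \<bullet> (x - x' - n)"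
      using mono zero[OF x] zero[OF x'] by (simp add: inner_diff_left inner_diff_right)
    also have "\<dots> \<le> norm (G x - G x') * norm (x - x' - n)" by (rule norm_cauchy_schwarz)
    also have "\<dots> \<le> (\<Lambda> * norm (x - x')) * (C * norm (A *v x - A *v x'))"
      using lip n(3) \<Lambda> by (intro mult_mono) auto
    finally have "norm (x - x') * (m * norm (x - x')) \<le>
        norm (x - x') * (\<Lambda> * C * norm (A *v x - A *v x'))"
      by (simp add: power2_eq_square algebra_simps)
    then have "x = x' \<or> m * norm (x - x') \<le> \<Lambda> * C * norm (A *v x - A *v x')"
      by (auto simp: mult_le_cancel_left)
    then show "norm (x - x') \<le> \<Lambda> * C / m * norm (A *v x - A *v x')"
      using m \<Lambda> C by (auto simp: field_simps)
  qed
qed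

text \<open>For fixed \<open>J\<close> every condition on the pair of parameter and point survives
  limits, so the pairs form a compact set; the parameters are its projection.\<close>

lemma closed_face_sol_parameters:
  fixes A :: "real^'n^'m" and a :: "real \<Rightarrow> real^'m"
  assumes G: "continuous_on (cbox l u) G" and a: "continuous_on {0..1} a"
  shows "closed {s\<in>{0..1}. \<exists>x\<in>cbox l u. A *v x = a s \<and> face_sol G A l u J x}"
proof -
  define Z where "Z = {w \<in> {0..1::real} \<times> cbox l u. A *v snd w = a (fst w) \<and> face_sol G A l u J (snd w)}"
  have "closed Z"
    unfolding closed_sequential_limits
  proof (intro allI impI)
    fix w w' assume w: "(\<forall>n. w n \<in> Z) \<and> w \<longlonglongrightarrow> w'"
    then have wn: "w n \<in> {0..1} \<times> cbox l u" "A *v snd (w n) = a (fst (w n))"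
        "face_sol G A l u J (snd (w n))" for n
      by (auto simp: Z_def)
    have w': "w' \<in> {0..1} \<times> cbox l u"
      using w wn(1) closed_sequentially[of "{0..1} \<times> cbox l u" w w']
      by (auto intro: closed_Times)
    have fst: "(\<lambda>n. fst (w n)) \<longlonglongrightarrow> fst w'" and snd: "(\<lambda>n. snd (w n)) \<longlonglongrightarrow> snd w'"
      using w by (auto intro: tendsto_fst tendsto_snd)
    have Gw: "(\<lambda>n. G (snd (w n))) \<longlonglongrightarrow> G (snd w')"
      by (rule continuous_on_tendsto_compose[OF G snd]) (use w' wn in \<open>auto simp: mem_Times_iff\<close>)
    have aw: "(\<lambda>n. a (fst (w n))) \<longlonglongrightarrow> a (fst w')"
      by (rule continuous_on_tendsto_compose[OF a fst]) (use w' wn in \<open>auto simp: mem_Times_iff\<close>)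
    have "(\<lambda>n. a (fst (w n))) \<longlonglongrightarrow> A *v snd w'"
      using bounded_linear.tendsto[OF matrix_vector_mul_bounded_linear snd, of A]
      unfolding wn(2) .
    then have "A *v snd w' = a (fst w')"
      using aw by (rule LIMSEQ_unique)
    moreover have "snd w' $ i = k" if "\<And>n. snd (w n) $ i = k" for i k
    proof -
      have "(\<lambda>n. k) \<longlonglongrightarrow> snd w' $ i"
        using tendsto_vec_nth[OF snd, of i] unfolding that .
      then show ?thesis by (rule LIMSEQ_unique[OF _ tendsto_const])
    qed
    moreover have "0 \<le> G (snd w') \<bullet> d" if "\<And>n. 0 \<le> G (snd (w n)) \<bullet> d" for d
      by (rule LIMSEQ_le_const[OF tendsto_inner[OF Gw tendsto_const]]) (intro exI allI impI that)
    ultimately show "w' \<in> Z"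
      using w' wn(3) unfolding Z_def face_sol_def mem_Collect_eq by blast
  qed
  moreover have "bounded Z"
    by (rule bounded_subset[of "{0..1} \<times> cbox l u"])
      (auto simp: Z_def intro: bounded_Times)
  ultimately have "compact (fst ` Z)"
    by (intro compact_continuous_image continuous_intros) (simp add: compact_eq_bounded_closed)
  moreover have "{s\<in>{0..1}. \<exists>x\<in>cbox l u. A *v x = a s \<and> face_sol G A l u J x} = fst ` Z"
    by (force simp: Z_def)
  ultimately show ?thesis by (simp add: compact_imp_closed)
qed

text \<open>Moving from the slice through \<open>x\<^sub>0\<close> to the slice through \<open>x\<^sub>1\<close>, the interval of
  parameters splits into finitely many closed sets, one per certifying face, and on each of
  them the solution is Lipschitz with a constant depending only on the face.\<close>

lemma vi_sol_slice_error_bound: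
  fixes A :: "real^'n^'m" and l u :: "real^'n"
  assumes box: "\<And>i. l $ i < u $ i" and m: "0 < m" and \<Lambda>: "0 < \<Lambda>"
  obtains C where "0 < C"
    and "\<And>G x\<^sub>0 x\<^sub>1.
      \<lbrakk>\<And>x x'. x \<in> cbox l u \<Longrightarrow> x' \<in> cbox l u \<Longrightarrow> norm (G x - G x') \<le> \<Lambda> * norm (x - x');
       \<And>x x'. x \<in> cbox l u \<Longrightarrow> x' \<in> cbox l u \<Longrightarrow>
         m * (norm (x - x'))\<^sup>2 \<le> (G x - G x') \<bullet> (x - x');
       \<And>q. q \<in> cbox l u \<Longrightarrow> \<exists>x. vi_sol G A l u q x;
       vi_sol G A l u x\<^sub>0 x\<^sub>0; vi_sol G A l u x\<^sub>1 x\<^sub>1\<rbrakk>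
      \<Longrightarrow> norm (x\<^sub>1 - x\<^sub>0) \<le> C * norm (A *v x\<^sub>1 - A *v x\<^sub>0)"
proof -
  have "\<exists>C>0. \<forall>G x x'. face_sol G A l u J x \<longrightarrow> face_sol G A l u J x' \<longrightarrow>
      norm (G x - G x') \<le> \<Lambda> * norm (x - x') \<longrightarrow>
      m * (norm (x - x'))\<^sup>2 \<le> (G x - G x') \<bullet> (x - x') \<longrightarrow>
      norm (x - x') \<le> C * norm (A *v x - A *v x')" for J
    by (rule face_sol_dist_bound[OF m \<Lambda>, of A l u J]) blast
  then obtain C where Cpos: "\<And>J. C J > 0" and C: "\<And>J G x x'. \<lbrakk>face_sol G A l u J x;
      face_sol G A l u J x'; norm (G x - G x') \<le> \<Lambda> * norm (x - x');
      m * (norm (x - x'))\<^sup>2 \<le> (G x - G x') \<bullet> (x - x')\<rbrakk>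
      \<Longrightarrow> norm (x - x') \<le> C J * norm (A *v x - A *v x')"
    by metis
  \<comment> \<open>Summing over all pairs of index sets, of which there are finitely many, gives
    one constant for all faces.\<close>
  define D where "D = sum C UNIV"
  have CD: "C J \<le> D" for J
    unfolding D_def by (rule member_le_sum) (auto intro: less_imp_le Cpos)
  have D: "0 < D" using Cpos CD less_le_trans by blast
  show ?thesis
  proof (rule that[OF D])
    fix G x\<^sub>0 x\<^sub>1
    assume lip: "\<And>x x'. x \<in> cbox l u \<Longrightarrow> x' \<in> cbox l u \<Longrightarrow>
        norm (G x - G x') \<le> \<Lambda> * norm (x - x')"
      and mono: "\<And>x x'. x \<in> cbox l u \<Longrightarrow> x' \<in> cbox l u \<Longrightarrow>
        m * (norm (x - x'))\<^sup>2 \<le> (G x - G x') \<bullet> (x - x')"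
      and ex: "\<And>q. q \<in> cbox l u \<Longrightarrow> \<exists>x. vi_sol G A l u q x"
      and sol: "vi_sol G A l u x\<^sub>0 x\<^sub>0" "vi_sol G A l u x\<^sub>1 x\<^sub>1"
    have x01: "x\<^sub>0 \<in> cbox l u" "x\<^sub>1 \<in> cbox l u" using sol by (auto simp: vi_sol_def)
    \<comment> \<open>By convexity these points stay in the box, so each intermediate slice is
      nonempty and has a solution \<open>h s\<close>.\<close>
    define q where "q s = x\<^sub>0 + s *\<^sub>R (x\<^sub>1 - x\<^sub>0)" for s
    have q: "q s \<in> cbox l u" if "s \<in> {0..1}" for s
    proof -
      have "q s = (1 - s) *\<^sub>R x\<^sub>0 + s *\<^sub>R x\<^sub>1" by (simp add: q_def algebra_simps)
      then show ?thesis using that x01 convex_box(1)[of l u] by (auto simp: convex_alt)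
    qed
    have "\<exists>h. \<forall>s\<in>{0..1}. vi_sol G A l u (q s) (h s)"
      using ex q by (intro bchoice) blast
    then obtain h where h: "\<And>s. s \<in> {0..1} \<Longrightarrow> vi_sol G A l u (q s) (h s)" by blast
    have unique: "h s = x" if "s \<in> {0..1}" "vi_sol G A l u (q s) x" for s x
      using vi_sol_unique[OF h[OF that(1)] that(2) m] mono h[OF that(1)] that(2)
      by (auto simp: vi_sol_def)
    have hbox: "h s \<in> cbox l u" and Ah: "A *v h s = A *v q s" if "s \<in> {0..1}" for s
      using h[OF that] by (auto simp: vi_sol_def)
    have Aq: "A *v q s = A *v x\<^sub>0 + s *\<^sub>R (A *v (x\<^sub>1 - x\<^sub>0))" for s
      by (simp add: q_def matrix_vector_right_distrib matrix_vector_mult_scaleR)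
    define M where "M = D * norm (A *v (x\<^sub>1 - x\<^sub>0))"
    define T where "T J = {s\<in>{0..1}. face_sol G A l u J (h s)}" for J
    have "lipschitz_on M {0..1} h"
    proof (rule lipschitz_on_closed_Union)
      show "lipschitz_on M (T J) h" for J
      proof (rule lipschitz_onI)
        fix s s' assume "s \<in> T J" "s' \<in> T J"
        then have s: "s \<in> {0..1}" "s' \<in> {0..1}" "face_sol G A l u J (h s)"
          "face_sol G A l u J (h s')" by (auto simp: T_def)
        have "norm (h s - h s') \<le> C J * norm (A *v h s - A *v h s')"
          using C[OF s(3,4)] lip mono hbox s by blast
        also have "\<dots> \<le> D * norm (A *v h s - A *v h s')"
          by (intro mult_right_mono CD) simp
        also have "A *v h s - A *v h s' = (s - s') *\<^sub>R (A *v (x\<^sub>1 - x\<^sub>0))"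
          by (simp only: Ah[OF s(1)] Ah[OF s(2)] Aq) (simp add: algebra_simps)
        finally show "dist (h s) (h s') \<le> M * dist s s'"
          by (simp add: M_def dist_norm mult_ac)
      qed (use D in \<open>simp add: M_def\<close>)
      show "closed (T J)" for J
      proof -
        have "continuous_on (cbox l u) G"
          using lip \<Lambda> by (intro lipschitz_on_continuous_on[of \<Lambda>] lipschitz_onI)
            (auto simp: dist_norm)
        moreover have "continuous_on {0..1} (\<lambda>s. A *v q s)"
          unfolding Aq by (intro continuous_intros)
        ultimately have "closed {s\<in>{0..1}. \<exists>x\<in>cbox l u. A *v x = A *v q s \<and> face_sol G A l u J x}"
          by (rule closed_face_sol_parameters)
        \<comment> \<open>A point certified by \<open>J\<close> solves the inequality on the slice
          of \<open>q s\<close>, so by uniqueness it is \<open>h s\<close>.\<close>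
        moreover have "T J = {s\<in>{0..1}. \<exists>x\<in>cbox l u. A *v x = A *v q s \<and> face_sol G A l u J x}"
          unfolding T_def using unique face_sol_imp_vi_sol hbox Ah by (metis (lifting))
        ultimately show ?thesis by simp
      qed
      show "{0..1} \<subseteq> (\<Union>J\<in>UNIV. T J)"
        using vi_sol_imp_face_sol[OF box h] by (fastforce simp: T_def)
    qed (use D in \<open>auto simp: M_def\<close>)
    then have "norm (h 1 - h 0) \<le> M"
      by (auto dest!: lipschitz_onD[of _ _ _ 1 0] simp: dist_norm)
    moreover have "h 1 = x\<^sub>1" "h 0 = x\<^sub>0" using unique[of 1 x\<^sub>1] unique[of 0 x\<^sub>0] sol
      by (auto simp: q_def)
    ultimately show "norm (x\<^sub>1 - x\<^sub>0) \<le> D * norm (A *v x\<^sub>1 - A *v x\<^sub>0)"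
      by (simp add: M_def matrix_vector_mult_diff_distrib)
  qed
qed

section \<open>Gradients, first-order optimality and distances along subsequences\<close>

lemma differentiable_imp_GDERIV_gradient:
  fixes f :: "'a::euclidean_space \<Rightarrow> real"
  assumes "f differentiable (at x)"
  shows "GDERIV f x :> gradient f x"
proof -
  obtain D where D: "(f has_derivative D) (at x)" using assms by (auto simp: differentiable_def)
  define g where "g = (\<Sum>i\<in>Basis. D i *\<^sub>R i)"
  have "D h = h \<bullet> g" for h
  proof -
    interpret D: linear D using has_derivative_linear[OF D] .
    have "D h = D (\<Sum>i\<in>Basis. (h \<bullet> i) *\<^sub>R i)" by (simp add: euclidean_representation)
    also have "\<dots> = (\<Sum>i\<in>Basis. (h \<bullet> i) * D i)" by (simp add: D.sum D.scale)
    also have "\<dots> = h \<bullet> g" by (simp add: g_def inner_sum_right mult.commute)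
    finally show ?thesis .
  qed
  then have "D = (\<lambda>h. h \<bullet> g)" by blast
  then have "GDERIV f x :> g" using D by (simp add: gderiv_def)
  then show ?thesis using gradient_eqI by blast
qed

lemma GDERIV_line:
  assumes "GDERIV h (x + t *\<^sub>R d) :> g"
  shows "((\<lambda>s. h (x + s *\<^sub>R d)) has_real_derivative g \<bullet> d) (at t)"
proof -
  have "((\<lambda>s. x + s *\<^sub>R d) has_derivative (\<lambda>s. s *\<^sub>R d)) (at t)"
    by (auto intro!: derivative_eq_intros)
  from has_derivative_compose[OF this assms[unfolded gderiv_def]]
  have "((\<lambda>s. h (x + s *\<^sub>R d)) has_derivative (\<lambda>s. (s *\<^sub>R d) \<bullet> g)) (at t)" .
  then show ?thesis
    by (rule has_derivative_imp_has_field_derivative) (simp add: inner_commute)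
qed

lemma minimizer_imp_vi:
  assumes "convex S" "x \<in> S" "x' \<in> S" "\<And>w. w \<in> S \<Longrightarrow> h x \<le> h w" "GDERIV h x :> g"
  shows "0 \<le> g \<bullet> (x' - x)"
proof (rule ccontr)
  assume "\<not> 0 \<le> g \<bullet> (x' - x)"
  moreover have "((\<lambda>s. h (x + s *\<^sub>R (x' - x))) has_real_derivative g \<bullet> (x' - x)) (at 0)"
    using assms(5) by (intro GDERIV_line) simp
  ultimately obtain d where d: "0 < d"
      "\<And>s. 0 < s \<Longrightarrow> s < d \<Longrightarrow> h (x + s *\<^sub>R (x' - x)) < h x"
    using DERIV_neg_dec_right[of "\<lambda>s. h (x + s *\<^sub>R (x' - x))" "g \<bullet> (x' - x)" 0] by auto
  define s where "s = min (d / 2) 1"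
  have s: "0 < s" "s < d" "s \<le> 1" using d(1) by (auto simp: s_def min_def)
  have "x + s *\<^sub>R (x' - x) = (1 - s) *\<^sub>R x + s *\<^sub>R x'" by (simp add: algebra_simps)
  then have "x + s *\<^sub>R (x' - x) \<in> S" using assms s by (auto simp: convex_alt)
  then show False using d(2)[OF s(1,2)] assms(4) by force
qed

text \<open>Indices at distance at least \<open>e\<close> from \<open>S\<close>, if infinite in
  number, form a subsequence contradicting the hypothesis. The hypothesis for the identity also
  provides a point of \<open>S\<close>, so the convention that \<open>infdist\<close> to the empty
  set is 0 cannot interfere.\<close>

lemma infdist_tendsto_0_subseqI:
  fixes s :: "nat \<Rightarrow> 'a::metric_space"
  assumes "\<And>r. strict_mono (r :: nat \<Rightarrow> nat) \<Longrightarrow>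
      \<exists>k w. strict_mono (k :: nat \<Rightarrow> nat) \<and> w \<in> S \<and> (\<lambda>n. s (r (k n))) \<longlonglongrightarrow> w"
  shows "(\<lambda>n. infdist (s n) S) \<longlonglongrightarrow> 0"
proof (rule ccontr)
  assume "\<not> ?thesis"
  then obtain e where e: "0 < e" "\<And>N. \<exists>n\<ge>N. e \<le> infdist (s n) S"
    by (auto simp: LIMSEQ_iff infdist_nonneg not_less)
  then have "\<exists>\<^sub>\<infinity>n. e \<le> infdist (s n) S" by (auto simp: INFM_nat_le)
  then have inf: "infinite {n. e \<le> infdist (s n) S}" by (simp add: frequently_cofinite)
  define r where "r = enumerate {n. e \<le> infdist (s n) S}"
  have r: "strict_mono r" "\<And>n. e \<le> infdist (s (r n)) S"
    using strict_mono_enumerate[OF inf] enumerate_in_set[OF inf] by (auto simp: r_def)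
  obtain k w where kw: "strict_mono k" "w \<in> S" "(\<lambda>n. s (r (k n))) \<longlonglongrightarrow> w"
    using assms[OF r(1)] by blast
  have "(\<lambda>n. infdist (s (r (k n))) S) \<longlonglongrightarrow> infdist w S"
    using kw(3) by (rule tendsto_infdist)
  then have "e \<le> infdist w S" by (rule LIMSEQ_le_const) (use r(2) in blast)
  with kw(2) e(1) show False by simp
qed

lemma norm_vector_matrix_le_onorm:
  fixes A :: "real^'n^'m"
  shows "norm (w v* A) \<le> onorm ((*v) A) * norm w"
proof -
  have "(norm (w v* A))\<^sup>2 = w \<bullet> (A *v (w v* A))"
    by (simp add: power2_norm_eq_inner dot_lmul_matrix)
  also have "\<dots> \<le> norm w * norm (A *v (w v* A))" by (rule norm_cauchy_schwarz)
  also have "\<dots> \<le> norm w * (onorm ((*v) A) * norm (w v* A))"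
    by (intro mult_left_mono onorm matrix_vector_mul_bounded_linear) simp
  finally have "norm (w v* A) * norm (w v* A) \<le> norm (w v* A) * (onorm ((*v) A) * norm w)"
    by (simp add: power2_eq_square mult_ac)
  then have "w v* A \<noteq> 0 \<longrightarrow> norm (w v* A) \<le> onorm ((*v) A) * norm w"
    by (auto simp: mult_le_cancel_left)
  then show ?thesis
    using onorm_pos_le[OF matrix_vector_mul_bounded_linear, of A] by (cases "w v* A = 0") auto
qed

subsection \<open>The proximal augmented Lagrangian\<close>

text \<open>The stepsizes are absent: constants obtained here precede the choice of \<alpha> and
  \<beta>, and can be used to bound them.\<close>

locale prox_alm =
  fixes f :: "real^'n \<Rightarrow> real" and A :: "real^'n^'m" and b :: "real^'m"
    and l u :: "real^'n" and L \<gamma> \<Gamma> p c :: real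
  assumes differentiable: "\<And>x. f differentiable (at x)"
    and box: "\<And>i. l $ i < u $ i"
    and relint: "0 \<in> rel_interior ((\<lambda>x. A *v x - b) ` cbox l u)"
    and L_pos: "L > 0"
    and lipschitz: "\<And>x x'. x \<in> cbox l u \<Longrightarrow> x' \<in> cbox l u \<Longrightarrow>
          norm (gradient f x - gradient f x') \<le> L * norm (x - x')"
    and gamma: "\<And>x x'. x \<in> cbox l u \<Longrightarrow> x' \<in> cbox l u \<Longrightarrow>
          (gradient f x - gradient f x') \<bullet> (x - x') \<ge> \<gamma> * (norm (x - x'))\<^sup>2"
    and Gamma_pos: "\<Gamma> > 0"
    and p_pos: "p > 0" and p_gt: "p > - \<gamma>"
    and c_pos: "0 < c" and c_less: "c < 1 / (L + p + \<Gamma> * (onorm ((*v) A))\<^sup>2)"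
begin

abbreviation K :: "real^'n \<Rightarrow> real^'n \<Rightarrow> real^'m \<Rightarrow> real" where
  "K \<equiv> prox_aug_lagrangian f A b \<Gamma> p"

abbreviation L\<^sub>K :: real where "L\<^sub>K \<equiv> L + p + \<Gamma> * (onorm ((*v) A))\<^sup>2"

definition K_grad :: "real^'n \<Rightarrow> real^'m \<Rightarrow> real^'n \<Rightarrow> real^'n" where
  "K_grad z y x = gradient f x + y v* A + \<Gamma> *\<^sub>R ((A *v x - b) v* A) + p *\<^sub>R (x - z)"

lemma L\<^sub>K_pos: "0 < L\<^sub>K"
  using L_pos p_pos Gamma_pos by (simp add: add_pos_nonneg)

lemma m_pos: "0 < p + \<gamma>"
  using p_gt by simp

lemma norm_A_le: "norm (A *v x) \<le> onorm ((*v) A) * norm x"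
  by (rule onorm[OF matrix_vector_mul_bounded_linear])

lemma GDERIV_K: "GDERIV (\<lambda>\<xi>. K \<xi> z y) x :> K_grad z y x"
proof -
  have A': "((\<lambda>\<xi>. A *v \<xi> - b) has_derivative (\<lambda>h. A *v h)) (at x)"
    by (auto intro!: derivative_eq_intros
        bounded_linear.has_derivative[OF matrix_vector_mul_bounded_linear])
  have f': "(f has_derivative (\<lambda>h. h \<bullet> gradient f x)) (at x)"
    using differentiable_imp_GDERIV_gradient[OF differentiable] by (simp add: gderiv_def)
  have "((\<lambda>\<xi>. f \<xi> + y \<bullet> (A *v \<xi> - b) + \<Gamma> / 2 * ((A *v \<xi> - b) \<bullet> (A *v \<xi> - b))
        + p / 2 * ((\<xi> - z) \<bullet> (\<xi> - z))) has_derivative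
      (\<lambda>h. h \<bullet> gradient f x + y \<bullet> (A *v h)
        + \<Gamma> / 2 * ((A *v x - b) \<bullet> (A *v h) + (A *v h) \<bullet> (A *v x - b))
        + p / 2 * ((x - z) \<bullet> h + h \<bullet> (x - z)))) (at x)"
    by (rule derivative_eq_intros A' f' refl)+ simp
  also have "(\<lambda>\<xi>. f \<xi> + y \<bullet> (A *v \<xi> - b) + \<Gamma> / 2 * ((A *v \<xi> - b) \<bullet> (A *v \<xi> - b))
        + p / 2 * ((\<xi> - z) \<bullet> (\<xi> - z))) = (\<lambda>\<xi>. K \<xi> z y)"
    by (simp add: prox_aug_lagrangian_def power2_norm_eq_inner)
  also have "(\<lambda>h. h \<bullet> gradient f x + y \<bullet> (A *v h)
        + \<Gamma> / 2 * ((A *v x - b) \<bullet> (A *v h) + (A *v h) \<bullet> (A *v x - b))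
        + p / 2 * ((x - z) \<bullet> h + h \<bullet> (x - z))) = (\<lambda>h. h \<bullet> K_grad z y x)"
  proof
    fix h
    have "h \<bullet> (w v* A) = w \<bullet> (A *v h)" for w by (metis dot_lmul_matrix inner_commute)
    then show "h \<bullet> gradient f x + y \<bullet> (A *v h)
        + \<Gamma> / 2 * ((A *v x - b) \<bullet> (A *v h) + (A *v h) \<bullet> (A *v x - b))
        + p / 2 * ((x - z) \<bullet> h + h \<bullet> (x - z)) = h \<bullet> K_grad z y x"
      unfolding inner_commute[of "A *v h" "A *v x - b"] inner_commute[of "x - z" h]
      by (simp add: K_grad_def inner_add_right)
  qed
  finally show ?thesis by (simp add: gderiv_def)
qed

lemma gradient_K: "gradient (\<lambda>\<xi>. K \<xi> z y) x = K_grad z y x"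
  by (rule gradient_eqI) (rule GDERIV_K)

lemma continuous_K: "continuous_on S (\<lambda>\<xi>. K \<xi> z y)"
  using GDERIV_K unfolding gderiv_def
  by (intro continuous_at_imp_continuous_on ballI) (blast intro: has_derivative_continuous)

text \<open>The multiplier and the prox center cancel, which makes the Lipschitz and monotonicity
  constants uniform in \<open>y\<close> and \<open>z\<close>.\<close>

lemma K_grad_diff:
  "K_grad z y x - K_grad z y x' = gradient f x - gradient f x'
    + \<Gamma> *\<^sub>R ((A *v (x - x')) v* A) + p *\<^sub>R (x - x')"
  by (simp add: K_grad_def algebra_simps vector_matrix_mult_diff_distrib)

lemma K_grad_lipschitz:
  assumes "x \<in> cbox l u" "x' \<in> cbox l u"
  shows "norm (K_grad z y x - K_grad z y x') \<le> L\<^sub>K * norm (x - x')"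
proof -
  let ?\<sigma> = "onorm ((*v) A)"
  have \<sigma>: "0 \<le> ?\<sigma>" by (rule onorm_pos_le[OF matrix_vector_mul_bounded_linear])
  have "norm ((A *v (x - x')) v* A) \<le> ?\<sigma> * norm (A *v (x - x'))"
    by (rule norm_vector_matrix_le_onorm)
  also have "\<dots> \<le> ?\<sigma> * (?\<sigma> * norm (x - x'))"
    by (intro mult_left_mono norm_A_le \<sigma>)
  finally have "\<Gamma> * norm ((A *v (x - x')) v* A) \<le> \<Gamma> * (?\<sigma>\<^sup>2 * norm (x - x'))"
    using Gamma_pos by (simp add: power2_eq_square mult_ac)
  moreover have "norm (K_grad z y x - K_grad z y x') \<le> norm (gradient f x - gradient f x')
      + norm (\<Gamma> *\<^sub>R ((A *v (x - x')) v* A)) + norm (p *\<^sub>R (x - x'))"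
    unfolding K_grad_diff by (meson add_mono_thms_linordered_semiring(3) norm_triangle_ineq order_trans)
  moreover have "norm (\<Gamma> *\<^sub>R ((A *v (x - x')) v* A)) = \<Gamma> * norm ((A *v (x - x')) v* A)"
    "norm (p *\<^sub>R (x - x')) = p * norm (x - x')"
    using Gamma_pos p_pos by auto
  ultimately show ?thesis
    using lipschitz[OF assms] unfolding distrib_right mult.assoc by linarith
qed

text \<open>The proximal term lifts the possibly negative modulus \<gamma> to
  \<open>p + \<gamma>\<close>; the penalty adds a nonnegative square.\<close>

lemma K_grad_mono:
  assumes "x \<in> cbox l u" "x' \<in> cbox l u"
  shows "(p + \<gamma>) * (norm (x - x'))\<^sup>2 \<le> (K_grad z y x - K_grad z y x') \<bullet> (x - x')"
proof -
  have "(K_grad z y x - K_grad z y x') \<bullet> (x - x') = (gradient f x - gradient f x') \<bullet> (x - x')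
      + \<Gamma> * (norm (A *v (x - x')))\<^sup>2 + p * (norm (x - x'))\<^sup>2"
    unfolding K_grad_diff by (simp add: inner_add_left dot_lmul_matrix power2_norm_eq_inner)
  moreover have "0 \<le> \<Gamma> * (norm (A *v (x - x')))\<^sup>2" using Gamma_pos by simp
  ultimately show ?thesis using gamma[OF assms] unfolding distrib_right by linarith
qed

text \<open>The factor \<open>1/2\<close> of the usual descent lemma is not needed, because \<open>c\<close> is strictly
  below \<open>1 / L\<^sub>K\<close> instead of \<open>2 / L\<^sub>K\<close>; the mean value theorem then suffices.\<close>

lemma K_descent:
  assumes "x \<in> cbox l u" "x' \<in> cbox l u"
  shows "K x' z y \<le> K x z y + K_grad z y x \<bullet> (x' - x) + L\<^sub>K * (norm (x' - x))\<^sup>2"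
proof -
  define q where "q s = x + s *\<^sub>R (x' - x)" for s
  have "((\<lambda>s. K (q s) z y) has_real_derivative K_grad z y (q s) \<bullet> (x' - x)) (at s)" for s
    unfolding q_def by (rule GDERIV_line) (rule GDERIV_K)
  then obtain s where s: "0 < s" "s < 1"
      "K (q 1) z y - K (q 0) z y = K_grad z y (q s) \<bullet> (x' - x)"
    using MVT2[of 0 1 "\<lambda>s. K (q s) z y" "\<lambda>s. K_grad z y (q s) \<bullet> (x' - x)"] by auto
  \<comment> \<open>The mean value point has to be in the box, where the Lipschitz bound is
    available.\<close>
  have "q s = (1 - s) *\<^sub>R x + s *\<^sub>R x'" by (simp add: q_def algebra_simps)
  then have qs: "q s \<in> cbox l u" using s assms convex_box(1)[of l u] by (auto simp: convex_alt)
  have "(K_grad z y (q s) - K_grad z y x) \<bullet> (x' - x)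
      \<le> norm (K_grad z y (q s) - K_grad z y x) * norm (x' - x)" by (rule norm_cauchy_schwarz)
  also have "\<dots> \<le> (L\<^sub>K * norm (q s - x)) * norm (x' - x)"
    by (intro mult_right_mono K_grad_lipschitz qs assms) simp
  also have "\<dots> \<le> (L\<^sub>K * norm (x' - x)) * norm (x' - x)"
    using s L\<^sub>K_pos by (intro mult_right_mono mult_left_mono) (auto simp: q_def mult_left_le_one_le)
  finally show ?thesis using s(3)
    by (simp add: q_def inner_diff_left power2_eq_square)
qed

section \<open>Minimizers over the box and over its slices, and their error bounds\<close>

lemma feasible: obtains q where "q \<in> cbox l u" "A *v q = b"
  using relint rel_interior_subset by fastforce

definition xmin :: "real^'n \<Rightarrow> real^'m \<Rightarrow> real^'n" where
  "xmin z y = (SOME x. x \<in> cbox l u \<and> (\<forall>w\<in>cbox l u. K x z y \<le> K w z y))"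

text \<open>The multiplier is 0 because its term vanishes at feasible points, so any other value
  would select among the same minimizers.\<close>

definition xfeas :: "real^'n \<Rightarrow> real^'n" where
  "xfeas z = (SOME x. x \<in> cbox l u \<and> A *v x = b \<and>
     (\<forall>w\<in>cbox l u. A *v w = b \<longrightarrow> K x z 0 \<le> K w z 0))"

lemma xmin_in: "xmin z y \<in> cbox l u"
  and xmin_le: "w \<in> cbox l u \<Longrightarrow> K (xmin z y) z y \<le> K w z y"
proof -
  have "cbox l u \<noteq> {}" using box by (simp add: interval_ne_empty_cart less_imp_le)
  then have "\<exists>x. x \<in> cbox l u \<and> (\<forall>w\<in>cbox l u. K x z y \<le> K w z y)"
    using continuous_attains_inf[OF compact_cbox _ continuous_K] by blast
  from someI_ex[OF this] show "xmin z y \<in> cbox l u"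
    and "w \<in> cbox l u \<Longrightarrow> K (xmin z y) z y \<le> K w z y"
    by (auto simp: xmin_def)
qed

lemma slice_minimizer:
  assumes "q \<in> cbox l u"
  obtains x where "x \<in> cbox l u" "A *v x = A *v q"
    "\<And>w. w \<in> cbox l u \<Longrightarrow> A *v w = A *v q \<Longrightarrow> K x z y \<le> K w z y"
proof -
  define S where "S = cbox l u \<inter> {w. A *v w = A *v q}"
  have "closed {w. A *v w = A *v q}"
    by (intro closed_Collect_eq bounded_linear.continuous_on[OF matrix_vector_mul_bounded_linear]
        continuous_intros)
  then have "compact S" unfolding S_def by (intro compact_Int_closed compact_cbox)
  moreover have "S \<noteq> {}" using assms by (auto simp: S_def)
  ultimately obtain x where "x \<in> S" "\<forall>w\<in>S. K x z y \<le> K w z y"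
    using continuous_attains_inf[OF _ _ continuous_K] by blast
  then show ?thesis by (intro that[of x]) (auto simp: S_def)
qed

lemma slice_minimizer_vi_sol:
  assumes "x \<in> cbox l u" "A *v x = A *v q"
    "\<And>w. w \<in> cbox l u \<Longrightarrow> A *v w = A *v q \<Longrightarrow> K x z y \<le> K w z y"
  shows "vi_sol (K_grad z y) A l u q x"
  unfolding vi_sol_def
proof (intro conjI assms(1,2) ballI impI)
  fix x' assume x': "x' \<in> cbox l u" "A *v x' = A *v q"
  have "convex (cbox l u \<inter> {w. A *v w = A *v q})"
    by (intro convex_Int convex_box)
      (auto simp: convex_alt matrix_vector_right_distrib matrix_vector_mult_scaleR
        simp flip: scaleR_left_distrib)
  then show "0 \<le> K_grad z y x \<bullet> (x' - x)"
    by (rule minimizer_imp_vi[where h = "\<lambda>\<xi>. K \<xi> z y"])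
      (use x' assms GDERIV_K in auto)
qed

lemma xfeas_in: "xfeas z \<in> cbox l u"
  and xfeas_A: "A *v xfeas z = b"
  and xfeas_le: "w \<in> cbox l u \<Longrightarrow> A *v w = b \<Longrightarrow> K (xfeas z) z 0 \<le> K w z 0"
proof -
  obtain q where q: "q \<in> cbox l u" "A *v q = b" by (rule feasible)
  have "\<exists>x. x \<in> cbox l u \<and> A *v x = b \<and> (\<forall>w\<in>cbox l u. A *v w = b \<longrightarrow> K x z 0 \<le> K w z 0)"
    by (rule slice_minimizer[OF q(1), of z 0]) (use q in auto)
  from someI_ex[OF this] show "xfeas z \<in> cbox l u" "A *v xfeas z = b"
    "w \<in> cbox l u \<Longrightarrow> A *v w = b \<Longrightarrow> K (xfeas z) z 0 \<le> K w z 0"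
    by (auto simp: xfeas_def)
qed

lemma xmin_vi:
  assumes "w \<in> cbox l u"
  shows "0 \<le> K_grad z y (xmin z y) \<bullet> (w - xmin z y)"
  by (rule minimizer_imp_vi[where h = "\<lambda>\<xi>. K \<xi> z y", OF convex_box(1) xmin_in assms])
    (auto intro: xmin_le GDERIV_K)

text \<open>On the slice through \<open>xmin z y\<close> the multiplier term is constant, so this
  point solves the inequality of \<open>K_grad z 0\<close> there, whatever \<open>y\<close> is;
  \<open>xfeas z\<close> solves it on the feasible slice. The slice bound compares the two, with a
  constant free of \<open>z\<close> and \<open>y\<close>.\<close>

lemma dual_error_bound:
  obtains C where "0 < C"
    and "\<And>z y. norm (xmin z y - xfeas z) \<le> C * norm (A *v xmin z y - b)"
proof -
  obtain C where C: "0 < C" "\<And>G x\<^sub>0 x\<^sub>1.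
      \<lbrakk>\<And>x x'. x \<in> cbox l u \<Longrightarrow> x' \<in> cbox l u \<Longrightarrow> norm (G x - G x') \<le> L\<^sub>K * norm (x - x');
       \<And>x x'. x \<in> cbox l u \<Longrightarrow> x' \<in> cbox l u \<Longrightarrow>
         (p + \<gamma>) * (norm (x - x'))\<^sup>2 \<le> (G x - G x') \<bullet> (x - x');
       \<And>q. q \<in> cbox l u \<Longrightarrow> \<exists>x. vi_sol G A l u q x;
       vi_sol G A l u x\<^sub>0 x\<^sub>0; vi_sol G A l u x\<^sub>1 x\<^sub>1\<rbrakk>
      \<Longrightarrow> norm (x\<^sub>1 - x\<^sub>0) \<le> C * norm (A *v x\<^sub>1 - A *v x\<^sub>0)"
    by (rule vi_sol_slice_error_bound[OF box m_pos L\<^sub>K_pos, where A = A]) blast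
  show ?thesis
  proof (rule that[OF C(1)])
    fix z y
    have "norm (xmin z y - xfeas z) \<le> C * norm (A *v xmin z y - A *v xfeas z)"
    proof (rule C(2)[of "K_grad z 0"])
      show "\<exists>x. vi_sol (K_grad z 0) A l u q x" if "q \<in> cbox l u" for q
        by (rule slice_minimizer[OF that, of z 0]) (blast intro: slice_minimizer_vi_sol)
      show "vi_sol (K_grad z 0) A l u (xfeas z) (xfeas z)"
        by (rule slice_minimizer_vi_sol) (simp_all add: xfeas_A xfeas_in xfeas_le)
      show "vi_sol (K_grad z 0) A l u (xmin z y) (xmin z y)"
        unfolding vi_sol_def
      proof (intro conjI ballI impI xmin_in refl)
        fix w assume w: "w \<in> cbox l u" "A *v w = A *v xmin z y"
        have "K_grad z y (xmin z y) \<bullet> (w - xmin z y)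
            = K_grad z 0 (xmin z y) \<bullet> (w - xmin z y) + y \<bullet> (A *v (w - xmin z y))"
          by (simp add: K_grad_def inner_add_left dot_lmul_matrix)
        then show "0 \<le> K_grad z 0 (xmin z y) \<bullet> (w - xmin z y)"
          using xmin_vi[OF w(1), of z y] w(2) by (simp add: matrix_vector_mult_diff_distrib)
      qed
    qed (auto intro: K_grad_lipschitz K_grad_mono)
    then show "norm (xmin z y - xfeas z) \<le> C * norm (A *v xmin z y - b)"
      by (simp add: xfeas_A)
  qed
qed

text \<open>Moving the center shifts the gradient by \<open>p *\<^sub>R (z - z')\<close>; adding the
  inequalities of both minimizers sets this shift against strong monotonicity.\<close>

lemma xmin_lipschitz_prox_center:
  "norm (xmin z y - xmin z' y) \<le> p / (p + \<gamma>) * norm (z - z')"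
proof -
  let ?x = "xmin z y" and ?x' = "xmin z' y"
  have "K_grad z' y ?x' = K_grad z y ?x' + p *\<^sub>R (z - z')"
    by (simp add: K_grad_def algebra_simps)
  then have "0 \<le> (K_grad z y ?x' + p *\<^sub>R (z - z')) \<bullet> (?x - ?x')"
    using xmin_vi[OF xmin_in, of z' y z y] by simp
  moreover have "0 \<le> K_grad z y ?x \<bullet> (?x' - ?x)" by (rule xmin_vi[OF xmin_in])
  ultimately have "(K_grad z y ?x - K_grad z y ?x') \<bullet> (?x - ?x') \<le> p * ((z - z') \<bullet> (?x - ?x'))"
    by (simp add: inner_add_left inner_diff_left inner_diff_right right_diff_distrib)
  also have "\<dots> \<le> p * (norm (z - z') * norm (?x - ?x'))"
    using p_pos by (intro mult_left_mono norm_cauchy_schwarz) simp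
  finally have "(K_grad z y ?x - K_grad z y ?x') \<bullet> (?x - ?x') \<le> p * (norm (z - z') * norm (?x - ?x'))" .
  moreover have "(p + \<gamma>) * (norm (?x - ?x'))\<^sup>2 \<le> (K_grad z y ?x - K_grad z y ?x') \<bullet> (?x - ?x')"
    by (intro K_grad_mono xmin_in)
  ultimately have "(p + \<gamma>) * (norm (?x - ?x'))\<^sup>2 \<le> p * (norm (z - z') * norm (?x - ?x'))"
    by (rule order_trans[rotated])
  then have "norm (?x - ?x') * ((p + \<gamma>) * norm (?x - ?x')) \<le> norm (?x - ?x') * (p * norm (z - z'))"
    by (simp add: power2_eq_square mult_ac)
  then have "?x \<noteq> ?x' \<longrightarrow> (p + \<gamma>) * norm (?x - ?x') \<le> p * norm (z - z')"
    by (auto simp: mult_le_cancel_left)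
  then show ?thesis using m_pos p_pos by (cases "?x = ?x'") (auto simp: field_simps)
qed

text \<open>The projection inequality is tested at the minimizer and the inequality of the minimizer
  at \<open>x'\<close>. The first contributes \<open>1 / c\<close>; replacing \<open>x\<close> by
  \<open>x'\<close> in the monotonicity estimate contributes \<open>L\<^sub>K\<close>.\<close>

lemma prox_gradient_error_bound:
  assumes "x \<in> cbox l u" "x' \<in> cbox l u"
    and proj: "\<And>w. w \<in> cbox l u \<Longrightarrow> (x - c *\<^sub>R K_grad z y x - x') \<bullet> (w - x') \<le> 0"
  shows "norm (x - xmin z y) \<le> (L\<^sub>K + 1 / c) / (p + \<gamma>) * norm (x' - x)"
proof -
  let ?h = "xmin z y"
  let ?g = "K_grad z y x" and ?gh = "K_grad z y (xmin z y)"
  have "(x - x') \<bullet> (?h - x') \<le> c * (?g \<bullet> (?h - x'))"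
    using proj[OF xmin_in, of z y] by (simp add: inner_diff_left)
  then have 1: "?g \<bullet> (x' - ?h) \<le> (1 / c) * ((x' - x) \<bullet> (?h - x'))"
    using c_pos by (simp add: field_simps inner_diff_left inner_diff_right)
  have "(x' - x) \<bullet> (?h - x') = (x' - x) \<bullet> (?h - x) - (norm (x' - x))\<^sup>2"
    by (simp add: power2_norm_eq_inner inner_diff_left inner_diff_right)
  also have "\<dots> \<le> (x' - x) \<bullet> (?h - x)" by simp
  also have "\<dots> \<le> norm (x' - x) * norm (?h - x)" by (rule norm_cauchy_schwarz)
  finally have 2: "?g \<bullet> (x' - ?h) \<le> (1 / c) * (norm (x' - x) * norm (x - ?h))"
    using 1 c_pos by (smt (verit) mult_left_mono norm_minus_commute zero_le_divide_1_iff)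
  have 3: "0 \<le> ?gh \<bullet> (x' - ?h)" by (rule xmin_vi[OF assms(2)])
  have "(?g - ?gh) \<bullet> (x - x') \<le> norm (?g - ?gh) * norm (x - x')" by (rule norm_cauchy_schwarz)
  also have "\<dots> \<le> (L\<^sub>K * norm (x - ?h)) * norm (x - x')"
    by (intro mult_right_mono K_grad_lipschitz assms xmin_in) simp
  finally have 4: "(?g - ?gh) \<bullet> (x - x') \<le> L\<^sub>K * (norm (x' - x) * norm (x - ?h))"
    by (simp add: norm_minus_commute mult_ac)
  have "(p + \<gamma>) * (norm (x - ?h))\<^sup>2 \<le> (?g - ?gh) \<bullet> (x - ?h)"
    by (rule K_grad_mono[OF assms(1) xmin_in])
  also have "\<dots> = (?g - ?gh) \<bullet> (x - x') + ?g \<bullet> (x' - ?h) - ?gh \<bullet> (x' - ?h)"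
    by (simp add: inner_diff_left inner_diff_right)
  also have "\<dots> \<le> (L\<^sub>K + 1 / c) * (norm (x' - x) * norm (x - ?h))"
    using 2 3 4 unfolding distrib_right[of L\<^sub>K] by linarith
  finally have "norm (x - ?h) * ((p + \<gamma>) * norm (x - ?h)) \<le>
      norm (x - ?h) * ((L\<^sub>K + 1 / c) * norm (x' - x))"
    by (simp only: power2_eq_square mult_ac)
  then have "x \<noteq> ?h \<longrightarrow> (p + \<gamma>) * norm (x - ?h) \<le> (L\<^sub>K + 1 / c) * norm (x' - x)"
    by (auto simp: mult_le_cancel_left)
  moreover have "0 \<le> (L\<^sub>K + 1 / c) * norm (x' - x)"
    using L\<^sub>K_pos c_pos by (intro mult_nonneg_nonneg[OF add_nonneg_nonneg[of L\<^sub>K]]) auto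
  ultimately show ?thesis using m_pos
    by (cases "x = ?h") (auto simp: pos_le_divide_eq mult.commute)
qed

end

subsection \<open>Descent of the potential\<close>

context prox_alm
begin

definition potential :: "real^'n \<Rightarrow> real^'n \<Rightarrow> real^'m \<Rightarrow> real" where
  "potential x z y = K x z y - 2 * K (xmin z y) z y + 2 * K (xfeas z) z 0"

text \<open>Weak duality: a feasible point competes in the box problem, and the multiplier term
  vanishes there.\<close>

lemma xmin_le_xfeas: "K (xmin z y) z y \<le> K (xfeas z) z 0"
  using xmin_le[OF xfeas_in, of z y z] by (simp add: prox_aug_lagrangian_def xfeas_A)

text \<open>The potential is (K - d) + (M - d) + M. The first two terms are nonnegative, and M is at
  least the minimum of \<open>f\<close> over the box.\<close>

lemma potential_bounded_below: "\<exists>B. \<forall>x\<in>cbox l u. \<forall>z y. B \<le> potential x z y"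
proof -
  have "continuous_on (cbox l u) f"
    by (intro differentiable_imp_continuous_on) (simp add: differentiable differentiable_at_imp_differentiable_on)
  moreover have "cbox l u \<noteq> {}" using xfeas_in by blast
  ultimately obtain w where w: "\<And>x. x \<in> cbox l u \<Longrightarrow> f w \<le> f x"
    using continuous_attains_inf[OF compact_cbox] by metis
  have "f w \<le> potential x z y" if "x \<in> cbox l u" for x z y
  proof -
    have "f w \<le> f (xfeas z)" by (rule w[OF xfeas_in])
    also have "\<dots> \<le> K (xfeas z) z 0"
      using p_pos by (simp add: prox_aug_lagrangian_def xfeas_A)
    finally show ?thesis
      using xmin_le[OF that, of z y] xmin_le_xfeas[of z y] by (simp add: potential_def)
  qed
  then show ?thesis by blast
qed

lemma K_change_center:
  "K x z' y = K x z y + p / 2 * ((z' - z) \<bullet> (z' + z - 2 *\<^sub>R x))"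
  by (simp add: prox_aug_lagrangian_def power2_norm_eq_inner algebra_simps inner_commute)

lemma K_change_multiplier:
  "K x z y' = K x z y + (y' - y) \<bullet> (A *v x - b)"
  by (simp add: prox_aug_lagrangian_def inner_diff_left)

text \<open>The projection inequality tested at the old point gains \<open>1 / c\<close>, and the
  descent estimate costs \<open>L\<^sub>K\<close>.\<close>

lemma primal_step:
  assumes "x \<in> cbox l u" "x' \<in> cbox l u"
    and "(x - c *\<^sub>R K_grad z y x - x') \<bullet> (x - x') \<le> 0"
  shows "K x' z y \<le> K x z y - (1 / c - L\<^sub>K) * (norm (x' - x))\<^sup>2"
proof -
  have "(norm (x' - x))\<^sup>2 \<le> c * (K_grad z y x \<bullet> (x - x'))"
    using assms(3) unfolding norm_minus_commute[of x' x] power2_norm_eq_inner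
    by (simp add: inner_diff_left algebra_simps)
  then have "K_grad z y x \<bullet> (x' - x) \<le> - (1 / c) * (norm (x' - x))\<^sup>2"
    using c_pos by (simp add: field_simps inner_diff_right)
  then show ?thesis using K_descent[OF assms(1,2), of z y] by (simp add: algebra_simps)
qed

text \<open>The distance to the center shrinks by the factor \<open>1 - \<beta>\<close>, and (1 -
  \<beta>)^2 \<le> 1 - \<beta>. Measured by the center step, the gain has a factor of order
  1/\<beta>, so for small \<beta> it outweighs every term with a fixed coefficient.\<close>

lemma center_step:
  assumes \<beta>: "0 < \<beta>" "\<beta> \<le> 1" and z': "z' = z + \<beta> *\<^sub>R (x - z)"
  shows "K x z' y \<le> K x z y - p / (2 * \<beta>) * (norm (z' - z))\<^sup>2"
proof -
  have 1: "(norm (x - z'))\<^sup>2 = (1 - \<beta>)\<^sup>2 * (norm (x - z))\<^sup>2"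
  proof -
    have "x - z' = (1 - \<beta>) *\<^sub>R (x - z)" by (simp add: z' algebra_simps)
    then show ?thesis by (simp add: power_mult_distrib)
  qed
  have 2: "(norm (z' - z))\<^sup>2 = \<beta>\<^sup>2 * (norm (x - z))\<^sup>2" by (simp add: z' power_mult_distrib)
  have "(1 - \<beta>)\<^sup>2 + \<beta> \<le> 1"
    using \<beta> mult_left_mono[of \<beta> 1 \<beta>] by (simp add: power2_eq_square algebra_simps)
  then have "((1 - \<beta>)\<^sup>2 + \<beta>) * (p / 2 * (norm (x - z))\<^sup>2) \<le> 1 * (p / 2 * (norm (x - z))\<^sup>2)"
    using p_pos by (intro mult_right_mono) auto
  moreover have "p / (2 * \<beta>) * (norm (z' - z))\<^sup>2 = \<beta> * (p / 2 * (norm (x - z))\<^sup>2)"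
    unfolding 2 using \<beta> by (simp add: power2_eq_square)
  moreover have "p / 2 * (norm (x - z'))\<^sup>2 = (1 - \<beta>)\<^sup>2 * (p / 2 * (norm (x - z))\<^sup>2)"
    unfolding 1 by simp
  ultimately show ?thesis
    unfolding prox_aug_lagrangian_def distrib_right by linarith
qed

text \<open>The dual residual enters with coefficient \<open>2\<alpha>\<close> from the ascent of the dual function and
  with \<open>- \<alpha>\<close> from the change of multiplier in \<open>K\<close>; completing the square leaves the error
  \<open>A (x - xmin z y')\<close>, which the primal step controls.\<close>

lemma potential_step:
  assumes \<beta>: "0 < \<beta>" "\<beta> \<le> 1" and x: "x \<in> cbox l u" "x' \<in> cbox l u"
    and y': "y' = y + \<alpha> *\<^sub>R (A *v x - b)" and z': "z' = z + \<beta> *\<^sub>R (x' - z)"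
    and proj: "(x - c *\<^sub>R K_grad z y' x - x') \<bullet> (x - x') \<le> 0"
  shows "potential x' z' y' \<le> potential x z y - (1 / c - L\<^sub>K) * (norm (x' - x))\<^sup>2
      + \<alpha> * (norm (A *v (x - xmin z y')))\<^sup>2 - \<alpha> * (norm (A *v xmin z y' - b))\<^sup>2
      - p / (2 * \<beta>) * (norm (z' - z))\<^sup>2 + 2 * p * ((z' - z) \<bullet> (xmin z' y' - xfeas z))"
proof -
  let ?r = "A *v x - b" and ?rh = "A *v xmin z y' - b"
  have "K x' z' y' \<le> K x' z y' - p / (2 * \<beta>) * (norm (z' - z))\<^sup>2"
    by (rule center_step[OF \<beta> z'])
  moreover have "K x' z y' \<le> K x z y' - (1 / c - L\<^sub>K) * (norm (x' - x))\<^sup>2"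
    by (rule primal_step[OF x proj])
  moreover have "K x z y' = K x z y + \<alpha> * (?r \<bullet> ?r)"
    by (subst K_change_multiplier[of _ _ y' y]) (simp add: y')
  \<comment> \<open>Trial points compare the optimal values: new box minimizers bound d from below,
    the old \<open>xfeas z\<close> bounds M from above. Hence the mixed difference
    \<open>xmin z' y' - xfeas z\<close> in the result.\<close>
  moreover have "K (xmin z y) z y \<le> K (xmin z y') z y" by (rule xmin_le[OF xmin_in])
  moreover have "K (xmin z y') z y' = K (xmin z y') z y + \<alpha> * (?r \<bullet> ?rh)"
    by (subst K_change_multiplier[of _ _ y' y]) (simp add: y')
  moreover have "K (xmin z y') z y' \<le> K (xmin z' y') z y'" by (rule xmin_le[OF xmin_in])
  moreover have "K (xmin z' y') z' y' = K (xmin z' y') z y'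
      + p / 2 * ((z' - z) \<bullet> (z' + z - 2 *\<^sub>R xmin z' y'))"
    by (rule K_change_center)
  moreover have "K (xfeas z') z' 0 \<le> K (xfeas z) z' 0" by (rule xfeas_le[OF xfeas_in xfeas_A])
  moreover have "K (xfeas z) z' 0 = K (xfeas z) z 0 + p / 2 * ((z' - z) \<bullet> (z' + z - 2 *\<^sub>R xfeas z))"
    by (rule K_change_center)
  moreover have "p * ((z' - z) \<bullet> (z' + z - 2 *\<^sub>R xfeas z)) - p * ((z' - z) \<bullet> (z' + z - 2 *\<^sub>R xmin z' y'))
      = 2 * p * ((z' - z) \<bullet> (xmin z' y' - xfeas z))"
    by (simp add: inner_diff_right inner_add_right algebra_simps)
  moreover have "\<alpha> * (norm (A *v (x - xmin z y')))\<^sup>2 = \<alpha> * (?r \<bullet> ?r) - 2 * (\<alpha> * (?r \<bullet> ?rh)) + \<alpha> * (norm ?rh)\<^sup>2"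
  proof -
    have "A *v (x - xmin z y') = ?r - ?rh" by (simp add: matrix_vector_mult_diff_distrib)
    then have "(norm (A *v (x - xmin z y')))\<^sup>2 = ?r \<bullet> ?r - 2 * (?r \<bullet> ?rh) + (norm ?rh)\<^sup>2"
      by (simp only: power2_norm_eq_inner) (simp add: inner_diff_left inner_diff_right inner_commute)
    then show ?thesis by (simp only: distrib_left right_diff_distrib)
  qed
  ultimately show ?thesis unfolding potential_def by linarith
qed

text \<open>Half of each gain is spent: the primal half pays for \<open>A *v (x - xmin z y')\<close>
  when \<alpha> is small, the dual and center halves for the inner product when \<beta> is small
  relative to \<alpha>.\<close>

lemma potential_descent:
  assumes C: "0 < C" "\<And>z y. norm (xmin z y - xfeas z) \<le> C * norm (A *v xmin z y - b)"
    and D: "D = (L\<^sub>K + 1 / c) / (p + \<gamma>)"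
    and \<alpha>: "0 < \<alpha>" "\<alpha> * (onorm ((*v) A) * D)\<^sup>2 \<le> (1 / c - L\<^sub>K) / 2"
    and \<beta>: "0 < \<beta>" "\<beta> \<le> 1" "\<beta> * (8 * p * C\<^sup>2 / \<alpha> + 8 * (p / (p + \<gamma>))) \<le> 1"
    and x: "x \<in> cbox l u" "x' \<in> cbox l u"
    and y': "y' = y + \<alpha> *\<^sub>R (A *v x - b)" and z': "z' = z + \<beta> *\<^sub>R (x' - z)"
    and proj: "\<And>w. w \<in> cbox l u \<Longrightarrow> (x - c *\<^sub>R K_grad z y' x - x') \<bullet> (w - x') \<le> 0"
  shows "potential x' z' y' \<le> potential x z y - (1 / c - L\<^sub>K) / 2 * (norm (x' - x))\<^sup>2
      - \<alpha> / 2 * (norm (A *v xmin z y' - b))\<^sup>2 - p / (4 * \<beta>) * (norm (z' - z))\<^sup>2"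
proof -
  let ?\<sigma> = "onorm ((*v) A)" and ?rh = "A *v xmin z y' - b" and ?E = "p / (p + \<gamma>)"
  have "norm (A *v (x - xmin z y')) \<le> ?\<sigma> * norm (x - xmin z y')" by (rule norm_A_le)
  also have "\<dots> \<le> ?\<sigma> * (D * norm (x' - x))"
    unfolding D by (intro mult_left_mono prox_gradient_error_bound x proj
        onorm_pos_le[OF matrix_vector_mul_bounded_linear])
  finally have "(norm (A *v (x - xmin z y')))\<^sup>2 \<le> (?\<sigma> * (D * norm (x' - x)))\<^sup>2"
    by (rule power_mono) simp
  then have "\<alpha> * (norm (A *v (x - xmin z y')))\<^sup>2 \<le> \<alpha> * ((?\<sigma> * D)\<^sup>2 * (norm (x' - x))\<^sup>2)"
    using \<alpha>(1) by (intro mult_left_mono) (auto simp: power_mult_distrib mult_ac)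
  also have "\<dots> \<le> (1 / c - L\<^sub>K) / 2 * (norm (x' - x))\<^sup>2"
    using mult_right_mono[OF \<alpha>(2), of "(norm (x' - x))\<^sup>2"] by (simp add: mult.assoc)
  finally have 1: "\<alpha> * (norm (A *v (x - xmin z y')))\<^sup>2 \<le> (1 / c - L\<^sub>K) / 2 * (norm (x' - x))\<^sup>2" .
  have "(z' - z) \<bullet> (xmin z' y' - xfeas z) \<le> norm (z' - z) * norm (xmin z' y' - xfeas z)"
    by (rule norm_cauchy_schwarz)
  also have "norm (xmin z' y' - xfeas z) \<le> ?E * norm (z' - z) + C * norm ?rh"
    using norm_triangle_ineq[of "xmin z' y' - xmin z y'" "xmin z y' - xfeas z"]
      xmin_lipschitz_prox_center[of z' y' z] C(2)[of z y'] by simp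
  finally have 2: "(z' - z) \<bullet> (xmin z' y' - xfeas z) \<le>
      norm (z' - z) * (?E * norm (z' - z) + C * norm ?rh)"
    by (simp add: mult_left_mono)
  \<comment> \<open>Young's inequality as a completed square, weighted so that exactly half of the
    dual gain is used.\<close>
  have "0 \<le> \<alpha> / 2 * (norm ?rh - 2 * p * C / \<alpha> * norm (z' - z))\<^sup>2"
    using \<alpha>(1) by simp
  also have "\<dots> = \<alpha> / 2 * (norm ?rh)\<^sup>2 - 2 * p * (norm (z' - z) * (C * norm ?rh))
      + 2 * p\<^sup>2 * C\<^sup>2 / \<alpha> * (norm (z' - z))\<^sup>2"
    using \<alpha>(1) by (simp add: power2_eq_square field_simps)
  finally have 3: "2 * p * (norm (z' - z) * (C * norm ?rh)) \<le> \<alpha> / 2 * (norm ?rh)\<^sup>2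
      + 2 * p\<^sup>2 * C\<^sup>2 / \<alpha> * (norm (z' - z))\<^sup>2" by simp
  \<comment> \<open>The bound on \<beta> is chosen to make this coefficient at most half of the
    center gain.\<close>
  have "2 * p\<^sup>2 * C\<^sup>2 / \<alpha> + 2 * p * ?E = p / (4 * \<beta>) * (\<beta> * (8 * p * C\<^sup>2 / \<alpha> + 8 * ?E))"
    using \<beta>(1) by (simp add: power2_eq_square algebra_simps)
  also have "\<dots> \<le> p / (4 * \<beta>) * 1"
    using \<beta> p_pos by (intro mult_left_mono) auto
  finally have "(2 * p\<^sup>2 * C\<^sup>2 / \<alpha> + 2 * p * ?E) * (norm (z' - z))\<^sup>2 \<le> p / (4 * \<beta>) * (norm (z' - z))\<^sup>2"
    by (intro mult_right_mono) auto
  moreover have "2 * p * ((z' - z) \<bullet> (xmin z' y' - xfeas z))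
      \<le> 2 * p * ?E * (norm (z' - z))\<^sup>2 + 2 * p * (norm (z' - z) * (C * norm ?rh))"
    using mult_left_mono[OF 2, of "2 * p"] p_pos by (simp add: power2_eq_square algebra_simps)
  ultimately have 4: "2 * p * ((z' - z) \<bullet> (xmin z' y' - xfeas z))
      \<le> p / (4 * \<beta>) * (norm (z' - z))\<^sup>2 + \<alpha> / 2 * (norm ?rh)\<^sup>2"
    using 3 unfolding distrib_right by linarith
  define a h q where "a = (1 / c - L\<^sub>K) / 2 * (norm (x' - x))\<^sup>2"
    and "h = \<alpha> / 2 * (norm ?rh)\<^sup>2" and "q = p / (4 * \<beta>) * (norm (z' - z))\<^sup>2"
  note ahq = a_def h_def q_def
  have "p / (2 * \<beta>) * (norm (z' - z))\<^sup>2 = 2 * q" "\<alpha> * (norm ?rh)\<^sup>2 = 2 * h"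
    "(1 / c - L\<^sub>K) * (norm (x' - x))\<^sup>2 = 2 * a" by (simp_all add: ahq)
  then show ?thesis
    using potential_step[OF \<beta>(1,2) x y' z' proj[OF x(1)]] 1 4
    unfolding ahq[symmetric] by linarith
qed

end

subsection \<open>Convergence of the iteration\<close>

lemma decrease_tendsto_0:
  fixes \<phi> e :: "nat \<Rightarrow> real"
  assumes "\<And>t. \<phi> (Suc t) \<le> \<phi> t - e t" "\<And>t. 0 \<le> e t" "\<And>t. B \<le> \<phi> t"
  shows "e \<longlonglongrightarrow> 0"
proof -
  have "decseq \<phi>" using assms(1,2) by (intro decseq_SucI) (smt (verit))
  then obtain k where k: "\<phi> \<longlonglongrightarrow> k" using decseq_convergent assms(3) by metis
  have "(\<lambda>t. \<phi> t - \<phi> (Suc t)) \<longlonglongrightarrow> k - k"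
    by (intro tendsto_diff k LIMSEQ_Suc)
  then have lim: "(\<lambda>t. \<phi> t - \<phi> (Suc t)) \<longlonglongrightarrow> 0" by simp
  have "e t \<le> \<phi> t - \<phi> (Suc t)" for t using assms(1)[of t] by linarith
  then show ?thesis
    by (intro tendsto_sandwich[OF _ _ tendsto_const lim] always_eventually allI assms(2))
qed

lemma norm_square_dominated_tendsto_0:
  fixes v :: "nat \<Rightarrow> 'a::real_normed_vector"
  assumes "e \<longlonglongrightarrow> 0" "0 < k" "\<And>t. k * (norm (v t))\<^sup>2 \<le> e t"
  shows "v \<longlonglongrightarrow> 0"
proof -
  have lim: "(\<lambda>t. sqrt (e t / k)) \<longlonglongrightarrow> 0"
    using tendsto_real_sqrt[OF tendsto_divide[OF assms(1) tendsto_const[of k]]] assms(2) by simp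
  have "norm (v t) \<le> sqrt (e t / k)" for t
    using assms(2,3) by (intro real_le_rsqrt) (simp add: pos_le_divide_eq mult.commute)
  then have "(\<lambda>t. norm (v t)) \<longlonglongrightarrow> 0"
    by (intro tendsto_sandwich[OF _ _ tendsto_const lim]) (auto intro!: always_eventually)
  then show ?thesis by (rule tendsto_norm_zero_cancel)
qed

text \<open>The bound multipliers are the positive and negative parts of \<open>g\<close>. Moving a
  single coordinate of \<open>x\<close> to a bound in the inequality yields complementarity.\<close>

lemma vi_imp_kkt:
  fixes A :: "real^'n^'m"
  assumes x: "x \<in> cbox l u" "A *v x = b"
    and vi: "\<And>w. w \<in> cbox l u \<Longrightarrow> 0 \<le> (gradient f x + y v* A) \<bullet> (w - x)"
  shows "(x, y) \<in> primal_dual_stationary_points f A b l u"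
proof -
  define g where "g = gradient f x + y v* A"
  define \<mu> \<nu> :: "real^'n" where "\<mu> = (\<chi> i. max (g $ i) 0)" and "\<nu> = (\<chi> i. max (- g $ i) 0)"
  have coord: "0 \<le> g $ i * (k - x $ i)" if "l $ i \<le> k" "k \<le> u $ i" for i k
  proof -
    have "x + axis i (k - x $ i) \<in> cbox l u"
      using x(1) that by (auto simp: mem_box_cart axis_def)
    from vi[OF this] show ?thesis by (simp add: g_def inner_axis)
  qed
  have b: "l $ i \<le> x $ i" "x $ i \<le> u $ i" for i using x(1) by (auto simp: mem_box_cart)
  have "\<mu> $ i * (l $ i - x $ i) = 0" "\<nu> $ i * (x $ i - u $ i) = 0" for i
    using coord[of i "l $ i"] coord[of i "u $ i"] b[of i]
    by (auto simp: \<mu>_def \<nu>_def max_def zero_le_mult_iff)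
  moreover have "g - \<mu> + \<nu> = 0" by (vector \<mu>_def \<nu>_def) (auto simp: max_def)
  ultimately have "kkt f A b l u x y \<mu> \<nu>"
    using x b by (auto simp: kkt_def g_def) (auto simp: \<mu>_def \<nu>_def)
  then show ?thesis by (auto simp: primal_dual_stationary_points_def)
qed

text \<open>As 0 is a residual, the affine hull of the residuals is their span. The box has interior
  points, so this span contains the whole range of \<open>A\<close>, and the relative ball covers
  all small vectors of that range.\<close>

lemma (in prox_alm) slater:
  obtains e where "0 < e"
    and "\<And>w. w \<in> range ((*v) A) \<Longrightarrow> norm w < e \<Longrightarrow> \<exists>q\<in>cbox l u. A *v q - b = w"
proof -
  define S where "S = (\<lambda>x. A *v x - b) ` cbox l u"
  obtain e where e: "0 < e" "ball 0 e \<inter> affine hull S \<subseteq> S" and "0 \<in> S"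
    using relint by (auto simp: mem_rel_interior_ball S_def)
  then have hull: "affine hull S = span S" by (intro affine_hull_span_0 hull_inc)
  have "A *v d \<in> span S" for d
  proof -
    define k where "k = (1 / 2) *\<^sub>R (l + u)"
    have "l $ i < k $ i \<and> k $ i < u $ i" for i
      using box[of i] by (simp add: k_def field_simps)
    then have "k \<in> box l u" by (simp add: mem_box_cart)
    then obtain r where r: "0 < r" "ball k r \<subseteq> box l u"
      using open_box open_contains_ball by metis
    \<comment> \<open>The added 1 covers \<open>d = 0\<close>; any direction becomes, after scaling,
      a difference of two box points.\<close>
    define s where "s = r / (norm d + 1)"
    have pos: "0 < norm d + 1" using norm_ge_zero[of d] by linarith
    then have s: "0 < s" using r by (simp add: s_def)
    have "norm (s *\<^sub>R d) < r"
      using r(1) pos by (simp add: s_def divide_less_eq)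
    then have "k + s *\<^sub>R d \<in> ball k r" by (simp add: dist_norm)
    moreover have "k \<in> ball k r" using r(1) by simp
    ultimately have "k + s *\<^sub>R d \<in> cbox l u" "k \<in> cbox l u"
      using r(2) box_subset_cbox[of l u] by blast+
    then have "A *v (k + s *\<^sub>R d) - b \<in> span S" "A *v k - b \<in> span S"
      by (auto simp: S_def intro!: span_base)
    from span_scale[OF span_diff[OF this], of "1 / s"] s show ?thesis
      by (simp add: matrix_vector_right_distrib matrix_vector_mult_scaleR)
  qed
  then have "w \<in> S" if "w \<in> range ((*v) A)" "norm w < e" for w
    using that e(2) hull by auto
  then show ?thesis using that[OF e(1)] by (fastforce simp: S_def)
qed

section \<open>A run of the method with small stepsizes\<close>

locale prox_alm_run = prox_alm f A b l u L \<gamma> \<Gamma> p c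
  for f :: "real^'n \<Rightarrow> real" and A :: "real^'n^'m" and b :: "real^'m"
    and l u :: "real^'n" and L \<gamma> \<Gamma> p c :: real +
  fixes C D \<alpha> \<beta> :: real and x z :: "nat \<Rightarrow> real^'n" and y :: "nat \<Rightarrow> real^'m"
  assumes C: "0 < C" "\<And>z y. norm (xmin z y - xfeas z) \<le> C * norm (A *v xmin z y - b)"
    and D: "D = (L\<^sub>K + 1 / c) / (p + \<gamma>)"
    and \<alpha>: "0 < \<alpha>" "\<alpha> * (onorm ((*v) A) * D)\<^sup>2 \<le> (1 / c - L\<^sub>K) / 2"
    and \<beta>: "0 < \<beta>" "\<beta> \<le> 1" "\<beta> * (8 * p * C\<^sup>2 / \<alpha> + 8 * (p / (p + \<gamma>))) \<le> 1"
    and run: "prox_inexact_ALM f A b l u \<Gamma> p c \<alpha> \<beta> x y z"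
begin

lemma y_Suc: "y (Suc t) = y t + \<alpha> *\<^sub>R (A *v x t - b)"
  and z_Suc: "z (Suc t) = z t + \<beta> *\<^sub>R (x (Suc t) - z t)"
  and x_Suc: "x (Suc t) = closest_point (cbox l u) (x t - c *\<^sub>R K_grad (z t) (y (Suc t)) (x t))"
  using run by (auto simp: prox_inexact_ALM_def gradient_K)

lemma x_in: "x t \<in> cbox l u"
proof (cases t)
  case 0
  then show ?thesis using run by (simp add: prox_inexact_ALM_def)
next
  case (Suc k)
  have "cbox l u \<noteq> {}" using xfeas_in by blast
  then show ?thesis unfolding Suc x_Suc by (intro closest_point_in_set closed_cbox)
qed

lemma z_in: "z t \<in> cbox l u"
proof (induction t)
  case 0
  show ?case using run by (simp add: prox_inexact_ALM_def)
next
  case (Suc t)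
  have "z (Suc t) = (1 - \<beta>) *\<^sub>R z t + \<beta> *\<^sub>R x (Suc t)" by (simp add: z_Suc algebra_simps)
  then show ?case using Suc x_in \<beta> convex_box(1)[of l u] by (auto simp: convex_alt)
qed

lemma proj:
  assumes "w \<in> cbox l u"
  shows "(x t - c *\<^sub>R K_grad (z t) (y (Suc t)) (x t) - x (Suc t)) \<bullet> (w - x (Suc t)) \<le> 0"
  unfolding x_Suc by (rule closest_point_dot[OF convex_box(1) closed_cbox assms])

lemma steps_tendsto_0:
  shows dx_tendsto: "(\<lambda>t. x (Suc t) - x t) \<longlonglongrightarrow> 0"
    and rh_tendsto: "(\<lambda>t. A *v xmin (z t) (y (Suc t)) - b) \<longlonglongrightarrow> 0"
    and dz_tendsto: "(\<lambda>t. z (Suc t) - z t) \<longlonglongrightarrow> 0"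
proof -
  let ?a = "(1 / c - L\<^sub>K) / 2"
  have a: "0 < ?a" using c_less c_pos L\<^sub>K_pos by (simp add: field_simps)
  define e where "e t = ?a * (norm (x (Suc t) - x t))\<^sup>2
      + \<alpha> / 2 * (norm (A *v xmin (z t) (y (Suc t)) - b))\<^sup>2
      + p / (4 * \<beta>) * (norm (z (Suc t) - z t))\<^sup>2" for t
  have nonneg: "0 \<le> ?a * (norm (x (Suc t) - x t))\<^sup>2"
    "0 \<le> \<alpha> / 2 * (norm (A *v xmin (z t) (y (Suc t)) - b))\<^sup>2"
    "0 \<le> p / (4 * \<beta>) * (norm (z (Suc t) - z t))\<^sup>2" for t
    using a \<alpha>(1) \<beta>(1) p_pos by (auto intro!: mult_nonneg_nonneg)
  obtain B where B: "\<And>t. B \<le> potential (x t) (z t) (y t)"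
    using potential_bounded_below x_in by blast
  have e: "e \<longlonglongrightarrow> 0"
  proof (rule decrease_tendsto_0[OF _ _ B])
    show "potential (x (Suc t)) (z (Suc t)) (y (Suc t)) \<le> potential (x t) (z t) (y t) - e t" for t
      using potential_descent[OF C D \<alpha> \<beta> x_in x_in y_Suc z_Suc proj, of t]
      unfolding e_def by linarith
    show "0 \<le> e t" for t unfolding e_def using nonneg[of t] by linarith
  qed
  have le: "?a * (norm (x (Suc t) - x t))\<^sup>2 \<le> e t"
    "\<alpha> / 2 * (norm (A *v xmin (z t) (y (Suc t)) - b))\<^sup>2 \<le> e t"
    "p / (4 * \<beta>) * (norm (z (Suc t) - z t))\<^sup>2 \<le> e t" for t
    unfolding e_def using nonneg[of t] by linarith+
  show "(\<lambda>t. x (Suc t) - x t) \<longlonglongrightarrow> 0"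
    by (rule norm_square_dominated_tendsto_0[OF e a le(1)])
  show "(\<lambda>t. A *v xmin (z t) (y (Suc t)) - b) \<longlonglongrightarrow> 0"
    by (rule norm_square_dominated_tendsto_0[OF e _ le(2)]) (use \<alpha> in simp)
  show "(\<lambda>t. z (Suc t) - z t) \<longlonglongrightarrow> 0"
    by (rule norm_square_dominated_tendsto_0[OF e _ le(3)]) (use \<beta> p_pos in simp)
qed

text \<open>The residual splits into the one at the box minimizer and the image under
  \<open>A\<close> of the distance to it, which the primal step bounds.\<close>

lemma residual_tendsto: "(\<lambda>t. A *v x t - b) \<longlonglongrightarrow> 0"
proof -
  have "(\<lambda>t. x t - xmin (z t) (y (Suc t))) \<longlonglongrightarrow> 0"
  proof (rule Lim_null_comparison)
    show "\<forall>\<^sub>F t in sequentially. norm (x t - xmin (z t) (y (Suc t))) \<le> D * norm (x (Suc t) - x t)"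
      unfolding D by (intro always_eventually allI prox_gradient_error_bound x_in proj)
    show "(\<lambda>t. D * norm (x (Suc t) - x t)) \<longlonglongrightarrow> 0"
      using tendsto_mult_right_zero[OF tendsto_norm_zero[OF dx_tendsto]] .
  qed
  from tendsto_add[OF bounded_linear.tendsto[OF matrix_vector_mul_bounded_linear this, of A] rh_tendsto]
  show ?thesis by (simp add: matrix_vector_mult_diff_distrib)
qed

lemma x_minus_z_tendsto: "(\<lambda>t. x t - z t) \<longlonglongrightarrow> 0"
proof -
  have "(\<lambda>t. (1 / \<beta>) *\<^sub>R (z (Suc t) - z t) - (x (Suc t) - x t)) \<longlonglongrightarrow> (1 / \<beta>) *\<^sub>R 0 - 0"
    by (intro tendsto_intros dz_tendsto dx_tendsto)
  moreover have "(1 / \<beta>) *\<^sub>R (z (Suc t) - z t) - (x (Suc t) - x t) = x t - z t" for t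
    using \<beta>(1) by (simp add: z_Suc)
  ultimately show ?thesis by simp
qed

text \<open>Since \<open>b\<close> is \<open>A *v xfeas 0\<close>, all residuals lie in the range of
  \<open>A\<close>, where \<open>slater\<close> applies; \<open>y 0\<close> is arbitrary, hence the
  difference.\<close>

lemma y_drift_in_range: "y t - y 0 \<in> range ((*v) A)"
proof (induction t)
  case 0
  show ?case by (rule range_eqI[of _ _ 0]) simp
next
  case (Suc t)
  then obtain d where d: "y t - y 0 = A *v d" by blast
  have "y (Suc t) - y 0 = (y t - y 0) + \<alpha> *\<^sub>R (A *v x t - A *v xfeas 0)"
    by (simp add: y_Suc xfeas_A)
  also have "\<dots> = A *v (d + \<alpha> *\<^sub>R (x t - xfeas 0))"
    by (simp add: d matrix_vector_right_distrib matrix_vector_mult_diff_distrib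
        matrix_vector_mult_scaleR)
  finally show ?case by blast
qed

text \<open>Testing the projection inequality with a box point whose residual is a fixed multiple
  of the direction opposite to \<open>y t - y 0\<close> bounds the length of \<open>y t - y 0\<close>, as soon as the
  residual of the iterate is small compared with that multiple.\<close>

lemma y_bounded: "bounded (range y)"
proof -
  obtain e where e: "0 < e"
    "\<And>w. w \<in> range ((*v) A) \<Longrightarrow> norm w < e \<Longrightarrow> \<exists>q\<in>cbox l u. A *v q - b = w"
    by (rule slater) blast
  define R where "R = diameter (cbox l u)"
  have R: "norm (w - w') \<le> R" if "w \<in> cbox l u" "w' \<in> cbox l u" for w w'
    using diameter_bounded_bound[OF bounded_cbox that] by (simp add: R_def dist_norm)
  have R0: "0 \<le> R" using R[OF x_in[of 0] x_in[of 0]] by simp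
  \<comment> \<open>A bound for the gradient with multiplier 0 along the run, anchored at the corner
    \<open>l\<close>.\<close>
  define B where "B = norm (K_grad l 0 l) + L\<^sub>K * R + p * R"
  have l_in: "l \<in> cbox l u" using box by (simp add: mem_box_cart less_imp_le)
  have B: "norm (K_grad (z t) 0 (x t)) \<le> B" for t
  proof -
    have eq: "K_grad (z t) 0 (x t) = K_grad l 0 l + (K_grad l 0 (x t) - K_grad l 0 l) + p *\<^sub>R (l - z t)"
      by (simp add: K_grad_def algebra_simps)
    have "norm (K_grad (z t) 0 (x t)) \<le> norm (K_grad l 0 l)
        + norm (K_grad l 0 (x t) - K_grad l 0 l) + norm (p *\<^sub>R (l - z t))"
      unfolding eq by (intro order_trans[OF norm_triangle_ineq] add_right_mono norm_triangle_ineq)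
    moreover have "norm (K_grad l 0 (x t) - K_grad l 0 l) \<le> L\<^sub>K * R"
      using K_grad_lipschitz[OF x_in l_in, of l 0 t] mult_left_mono[OF R[OF x_in l_in, of t], of L\<^sub>K] L\<^sub>K_pos
      by linarith
    moreover have "norm (p *\<^sub>R (l - z t)) \<le> p * R"
      using R[OF l_in z_in, of t] p_pos by simp
    ultimately show ?thesis unfolding B_def by linarith
  qed
  \<comment> \<open>The test point gains \<open>e / 2\<close> times the drift and the residual loses
    \<open>e / 4\<close> times it; the rest is divided by the difference
    \<open>e / 4\<close>.\<close>
  define M where "M = (3 * e / 4 * norm (y 0) + R\<^sup>2 / c + B * R) / (e / 4)"
  have M: "norm (y (Suc t) - y 0) \<le> M" if small: "norm (A *v x (Suc t) - b) \<le> e / 4" for t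
  proof (cases "y (Suc t) = y 0")
    case True
    have "0 \<le> B" using B[of 0] norm_ge_zero order_trans by blast
    then show ?thesis using e(1) c_pos R0 True by (simp add: M_def)
  next
    case False
    let ?w = "y (Suc t) - y 0" and ?x' = "x (Suc t)"
    have w: "0 < norm ?w" using False by simp
    have "- (e / (2 * norm ?w)) *\<^sub>R ?w \<in> range ((*v) A)"
    proof -
      obtain d where "?w = A *v d" using y_drift_in_range by blast
      then have "- (e / (2 * norm ?w)) *\<^sub>R ?w = A *v (- (e / (2 * norm ?w)) *\<^sub>R d)"
        by (simp only: matrix_vector_mult_scaleR)
      then show ?thesis by blast
    qed
    moreover have "norm (- (e / (2 * norm ?w)) *\<^sub>R ?w) < e" using w e(1) by simp
    ultimately obtain q where q: "q \<in> cbox l u" "A *v q - b = - (e / (2 * norm ?w)) *\<^sub>R ?w"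
      using e(2) by blast
    let ?G = "K_grad (z t) 0 (x t)"
    have "K_grad (z t) (y (Suc t)) (x t) = ?G + y (Suc t) v* A" by (simp add: K_grad_def)
    then have "(x t - ?x') \<bullet> (q - ?x') \<le> c * (?G \<bullet> (q - ?x') + y (Suc t) \<bullet> (A *v (q - ?x')))"
      using proj[OF q(1), of t]
      by (simp add: inner_diff_left inner_add_left dot_lmul_matrix algebra_simps)
    moreover have "- (R * R) \<le> (x t - ?x') \<bullet> (q - ?x')"
    proof -
      have "\<bar>(x t - ?x') \<bullet> (q - ?x')\<bar> \<le> norm (x t - ?x') * norm (q - ?x')"
        by (rule Cauchy_Schwarz_ineq2)
      also have "\<dots> \<le> R * R" by (intro mult_mono R x_in q R0) simp
      finally show ?thesis by simp
    qed
    ultimately have "- (R * R) \<le> c * (?G \<bullet> (q - ?x') + y (Suc t) \<bullet> (A *v (q - ?x')))"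
      by linarith
    then have "- (R * R) / c \<le> ?G \<bullet> (q - ?x') + y (Suc t) \<bullet> (A *v (q - ?x'))"
      unfolding pos_divide_le_eq[OF c_pos] by (simp only: mult.commute)
    moreover have "?G \<bullet> (q - ?x') \<le> B * R"
    proof -
      have "norm ?G * norm (q - ?x') \<le> B * R"
        by (intro mult_mono B R q(1) x_in order_trans[OF norm_ge_zero B]) simp
      then show ?thesis using norm_cauchy_schwarz[of ?G "q - ?x'"] by linarith
    qed
    moreover have "y (Suc t) \<bullet> (A *v (q - ?x'))
        = y (Suc t) \<bullet> (- (e / (2 * norm ?w)) *\<^sub>R ?w) - y (Suc t) \<bullet> (A *v ?x' - b)"
      unfolding q(2)[symmetric] inner_diff_right[symmetric]
      by (simp add: matrix_vector_mult_diff_distrib)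
    moreover have "y (Suc t) \<bullet> (- (e / (2 * norm ?w)) *\<^sub>R ?w) \<le> - (e / 2 * norm ?w) + e / 2 * norm (y 0)"
    proof -
      have "- (y 0 \<bullet> ?w) \<le> norm (y 0) * norm ?w"
        using Cauchy_Schwarz_ineq2[of "y 0" ?w] by linarith
      then have "e / (2 * norm ?w) * (- (y 0 \<bullet> ?w)) \<le> e / (2 * norm ?w) * (norm (y 0) * norm ?w)"
        using w e(1) by (intro mult_left_mono) auto
      moreover have "e / (2 * norm ?w) * (norm (y 0) * norm ?w) = e / 2 * norm (y 0)"
        using w by simp
      moreover have "e / (2 * norm ?w) * (?w \<bullet> ?w) = e / 2 * norm ?w"
        using w by (simp add: power2_norm_eq_inner[symmetric] power2_eq_square)
      moreover have "y (Suc t) \<bullet> (- (e / (2 * norm ?w)) *\<^sub>R ?w)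
          = e / (2 * norm ?w) * (- (y 0 \<bullet> ?w)) - e / (2 * norm ?w) * (?w \<bullet> ?w)"
        unfolding inner_scaleR_right by (simp only: inner_diff_left) (simp add: right_diff_distrib)
      ultimately show ?thesis by linarith
    qed
    moreover have "- (y (Suc t) \<bullet> (A *v ?x' - b)) \<le> (norm (y 0) + norm ?w) * (e / 4)"
    proof -
      have "norm (y (Suc t)) \<le> norm (y 0) + norm ?w"
        using norm_triangle_ineq[of "y 0" ?w] by simp
      then have "norm (y (Suc t)) * norm (A *v ?x' - b) \<le> (norm (y 0) + norm ?w) * (e / 4)"
        using small by (intro mult_mono) auto
      then show ?thesis using Cauchy_Schwarz_ineq2[of "y (Suc t)" "A *v ?x' - b"] by linarith
    qed
    ultimately have "e / 4 * norm ?w \<le> 3 * e / 4 * norm (y 0) + R\<^sup>2 / c + B * R"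
      unfolding power2_eq_square distrib_right minus_divide_left[symmetric]
      by (simp add: mult.commute)
    then show ?thesis using e(1) by (simp add: M_def pos_le_divide_eq mult.commute)
  qed
  have "\<forall>\<^sub>F t in sequentially. norm (A *v x (Suc t) - b) < e / 4"
    using order_tendstoD(2)[OF tendsto_norm_zero[OF LIMSEQ_Suc[OF residual_tendsto]], of "e / 4"] e(1)
    by simp
  then have "\<forall>\<^sub>F t in sequentially. norm (y (Suc t)) \<le> norm (y 0) + M"
  proof eventually_elim
    case (elim t)
    then show ?case using M[of t] norm_triangle_ineq[of "y 0" "y (Suc t) - y 0"] by simp
  qed
  then have "Bseq (\<lambda>t. y (Suc t))" by (rule BfunI)
  then show ?thesis by (simp add: Bseq_Suc_iff Bseq_eq_bounded)
qed

text \<open>Vanishing steps and residuals give the shifted sequences the same limits, and the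
  penalty and proximal parts of the gradient disappear. The positive factor \<open>c\<close> then
  cancels.\<close>

lemma limit_point_stationary:
  assumes r: "strict_mono (r :: nat \<Rightarrow> nat)"
    and xr: "(\<lambda>n. x (r n)) \<longlonglongrightarrow> x'" and yr: "(\<lambda>n. y (r n)) \<longlonglongrightarrow> y'"
  shows "(x', y') \<in> primal_dual_stationary_points f A b l u"
proof (rule vi_imp_kkt)
  have sub: "(\<lambda>n. s (r n)) \<longlonglongrightarrow> k" if "s \<longlonglongrightarrow> k" for s :: "nat \<Rightarrow> 'z::topological_space" and k
    using LIMSEQ_subseq_LIMSEQ[OF that r] by (simp add: o_def)
  show x': "x' \<in> cbox l u"
    using closed_sequentially[OF closed_cbox _ xr] x_in by blast
  have res: "(\<lambda>n. A *v x (r n) - b) \<longlonglongrightarrow> 0" by (rule sub[OF residual_tendsto])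
  moreover have "(\<lambda>n. A *v x (r n) - b) \<longlonglongrightarrow> A *v x' - b"
    by (intro tendsto_intros bounded_linear.tendsto[OF matrix_vector_mul_bounded_linear xr])
  ultimately have "0 = A *v x' - b" by (rule LIMSEQ_unique)
  then show Ax': "A *v x' = b" by simp
  have "(\<lambda>n. x (r n) + (x (Suc (r n)) - x (r n))) \<longlonglongrightarrow> x' + 0"
    by (intro tendsto_add xr sub[OF dx_tendsto])
  then have xs: "(\<lambda>n. x (Suc (r n))) \<longlonglongrightarrow> x'" by simp
  have "(\<lambda>n. y (r n) + \<alpha> *\<^sub>R (A *v x (r n) - b)) \<longlonglongrightarrow> y' + \<alpha> *\<^sub>R 0"
    by (intro tendsto_intros yr res)
  then have ys: "(\<lambda>n. y (Suc (r n))) \<longlonglongrightarrow> y'" by (simp add: y_Suc)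
  have "continuous_on (cbox l u) (gradient f)"
    using lipschitz L_pos by (intro lipschitz_on_continuous_on[of L] lipschitz_onI) (auto simp: dist_norm)
  then have gr: "(\<lambda>n. gradient f (x (r n))) \<longlonglongrightarrow> gradient f x'"
    by (rule continuous_on_tendsto_compose[OF _ xr]) (use x' x_in in auto)
  have vA: "(\<lambda>n. s n v* A) \<longlonglongrightarrow> k v* A" if "s \<longlonglongrightarrow> k" for s k
    using bounded_linear.tendsto[OF matrix_vector_mul_bounded_linear that, of "transpose A"] by simp
  have "(\<lambda>n. gradient f (x (r n)) + y (Suc (r n)) v* A + \<Gamma> *\<^sub>R ((A *v x (r n) - b) v* A)
      + p *\<^sub>R (x (r n) - z (r n))) \<longlonglongrightarrow> gradient f x' + y' v* A + \<Gamma> *\<^sub>R (0 v* A) + p *\<^sub>R 0"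
    by (intro tendsto_intros gr vA ys res sub[OF x_minus_z_tendsto])
  then have Kr: "(\<lambda>n. K_grad (z (r n)) (y (Suc (r n))) (x (r n))) \<longlonglongrightarrow> gradient f x' + y' v* A"
    by (simp add: K_grad_def)
  fix w assume w: "w \<in> cbox l u"
  have "(\<lambda>n. (x (r n) - c *\<^sub>R K_grad (z (r n)) (y (Suc (r n))) (x (r n)) - x (Suc (r n)))
      \<bullet> (w - x (Suc (r n)))) \<longlonglongrightarrow> (x' - c *\<^sub>R (gradient f x' + y' v* A) - x') \<bullet> (w - x')"
    by (intro tendsto_intros xr Kr xs)
  then have "(x' - c *\<^sub>R (gradient f x' + y' v* A) - x') \<bullet> (w - x') \<le> 0"
    by (rule LIMSEQ_le_const2) (use proj[OF w] in blast)
  then have "0 \<le> c * ((gradient f x' + y' v* A) \<bullet> (w - x'))" by simp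
  then show "0 \<le> (gradient f x' + y' v* A) \<bullet> (w - x')"
    using c_pos by (simp add: zero_le_mult_iff)
qed

text \<open>Compactness of the box and boundedness of \<open>y\<close> give a limit of the pairs;
  \<open>z\<close> follows \<open>x\<close> because their difference vanishes.\<close>

lemma convergent_subsequence:
  assumes r: "strict_mono (r :: nat \<Rightarrow> nat)"
  obtains k x' y' where "strict_mono (k :: nat \<Rightarrow> nat)"
    "(x', y') \<in> primal_dual_stationary_points f A b l u"
    "(\<lambda>n. x (r (k n))) \<longlonglongrightarrow> x'" "(\<lambda>n. y (r (k n))) \<longlonglongrightarrow> y'" "(\<lambda>n. z (r (k n))) \<longlonglongrightarrow> x'"
proof -
  have "bounded (cbox l u \<times> range y)" by (intro bounded_Times bounded_cbox y_bounded)
  then have "bounded (range (\<lambda>n. (x (r n), y (r n))))"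
    by (rule bounded_subset) (use x_in in auto)
  then obtain k w where k: "strict_mono k" "((\<lambda>n. (x (r n), y (r n))) \<circ> k) \<longlonglongrightarrow> w"
    using bounded_imp_convergent_subsequence by blast
  have x': "(\<lambda>n. x (r (k n))) \<longlonglongrightarrow> fst w" and y': "(\<lambda>n. y (r (k n))) \<longlonglongrightarrow> snd w"
    using tendsto_fst[OF k(2)] tendsto_snd[OF k(2)] by (simp_all add: o_def)
  have rk: "strict_mono (r \<circ> k)" using r k(1) by (rule strict_mono_o)
  have "(\<lambda>n. x (r (k n)) - z (r (k n))) \<longlonglongrightarrow> 0"
    using LIMSEQ_subseq_LIMSEQ[OF x_minus_z_tendsto rk] by (simp add: o_def)
  from tendsto_diff[OF x' this] have "(\<lambda>n. z (r (k n))) \<longlonglongrightarrow> fst w" by simp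
  moreover have "(fst w, snd w) \<in> primal_dual_stationary_points f A b l u"
    by (rule limit_point_stationary[OF rk]) (use x' y' in \<open>simp_all add: o_def\<close>)
  ultimately show ?thesis using that k(1) x' y' by blast
qed

lemma fst_stationary:
  "(x', y') \<in> primal_dual_stationary_points f A b l u \<Longrightarrow> x' \<in> stationary_points f A b l u"
  by (auto simp: primal_dual_stationary_points_def stationary_points_def)

lemma convergence:
  "(\<lambda>t. infdist (x t) (stationary_points f A b l u)) \<longlonglongrightarrow> 0"
  "(\<lambda>t. infdist (z t) (stationary_points f A b l u)) \<longlonglongrightarrow> 0"
  "(\<lambda>t. infdist (x t, y t) (primal_dual_stationary_points f A b l u)) \<longlonglongrightarrow> 0"
proof -
  show "(\<lambda>t. infdist (x t) (stationary_points f A b l u)) \<longlonglongrightarrow> 0"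
    by (rule infdist_tendsto_0_subseqI, erule convergent_subsequence) (blast intro: fst_stationary)
  show "(\<lambda>t. infdist (z t) (stationary_points f A b l u)) \<longlonglongrightarrow> 0"
    by (rule infdist_tendsto_0_subseqI, erule convergent_subsequence) (blast intro: fst_stationary)
  show "(\<lambda>t. infdist (x t, y t) (primal_dual_stationary_points f A b l u)) \<longlonglongrightarrow> 0"
  proof (rule infdist_tendsto_0_subseqI)
    fix r :: "nat \<Rightarrow> nat" assume "strict_mono r"
    then obtain k x' y' where k: "strict_mono (k :: nat \<Rightarrow> nat)"
      "(x', y') \<in> primal_dual_stationary_points f A b l u"
      "(\<lambda>n. x (r (k n))) \<longlonglongrightarrow> x'" "(\<lambda>n. y (r (k n))) \<longlonglongrightarrow> y'"
      by (rule convergent_subsequence)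
    then have "(\<lambda>n. (x (r (k n)), y (r (k n)))) \<longlonglongrightarrow> (x', y')" by (intro tendsto_Pair)
    with k show "\<exists>k w. strict_mono k \<and> w \<in> primal_dual_stationary_points f A b l u \<and>
        (\<lambda>n. (x (r (k n)), y (r (k n)))) \<longlonglongrightarrow> w" by blast
  qed
qed

end

theorem theorem2p4:
  fixes f :: "real^'n \<Rightarrow> real"
    and A :: "real^'n^'m" and b :: "real^'m"
    and l u :: "real^'n"
    and L \<gamma> \<Gamma> p c :: real
  assumes differentiable: "\<And>x. f differentiable (at x)"
    and box: "\<And>i. l $ i < u $ i"
    and relint: "0 \<in> rel_interior ((\<lambda>x. A *v x - b) ` cbox l u)"
    and strict_compl: "strict_complementarity f A b l u"
    and L_pos: "L > 0"
    and lipschitz: "\<And>x x'. x \<in> cbox l u \<Longrightarrow> x' \<in> cbox l u \<Longrightarrow>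
          norm (gradient f x - gradient f x') \<le> L * norm (x - x')"
    and gamma: "\<And>x x'. x \<in> cbox l u \<Longrightarrow> x' \<in> cbox l u \<Longrightarrow>
          (gradient f x - gradient f x') \<bullet> (x - x') \<ge> \<gamma> * (norm (x - x'))\<^sup>2"
    and Gamma_pos: "\<Gamma> > 0"
    and p_pos: "p > 0" and p_gt: "p > - \<gamma>"
    and c_pos: "0 < c" and c_less: "c < 1 / (L + p + \<Gamma> * (onorm ((*v) A))\<^sup>2)"
  shows "\<exists>\<alpha>\<^sub>0>0. \<forall>\<alpha>. 0 < \<alpha> \<and> \<alpha> < \<alpha>\<^sub>0 \<longrightarrow>
     (\<exists>\<beta>\<^sub>0>0. \<forall>\<beta>. 0 < \<beta> \<and> \<beta> \<le> 1 \<and> \<beta> < \<beta>\<^sub>0 \<longrightarrow>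
       (\<forall>x y z. prox_inexact_ALM f A b l u \<Gamma> p c \<alpha> \<beta> x y z \<longrightarrow>
          bounded (range y) \<and>
          (\<lambda>t. norm (x (Suc t) - x t)) \<longlonglongrightarrow> 0 \<and>
          (\<lambda>t. infdist (x t) (stationary_points f A b l u)) \<longlonglongrightarrow> 0 \<and>
          (\<lambda>t. infdist (z t) (stationary_points f A b l u)) \<longlonglongrightarrow> 0 \<and>
          (\<lambda>t. infdist (x t, y t) (primal_dual_stationary_points f A b l u)) \<longlonglongrightarrow> 0 \<and>
          (\<forall>w r. strict_mono (r :: nat \<Rightarrow> nat) \<and> ((\<lambda>t. (x t, y t)) \<circ> r) \<longlonglongrightarrow> w \<longrightarrow>
             w \<in> primal_dual_stationary_points f A b l u)))"
proof -
  interpret prox_alm f A b l u L \<gamma> \<Gamma> p c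
    by unfold_locales (fact differentiable box relint L_pos lipschitz gamma Gamma_pos p_pos p_gt
        c_pos c_less)+
  obtain C where C: "0 < C" "\<And>z y. norm (xmin z y - xfeas z) \<le> C * norm (A *v xmin z y - b)"
    by (rule dual_error_bound) blast
  define D where "D = (L\<^sub>K + 1 / c) / (p + \<gamma>)"
  define S where "S = (onorm ((*v) A) * D)\<^sup>2"
  have S: "0 \<le> S" by (simp add: S_def)
  have a: "0 < 1 / c - L\<^sub>K" using c_less c_pos L\<^sub>K_pos by (simp add: field_simps)
  \<comment> \<open>The added 1 keeps the threshold for \<alpha> well defined when \<open>S\<close>
    is 0, as for \<open>A = 0\<close>.\<close>
  have "0 < (1 / c - L\<^sub>K) / (2 * (S + 1))" using a S by simp
  moreover have "\<exists>\<beta>\<^sub>0>0. \<forall>\<beta>. 0 < \<beta> \<and> \<beta> \<le> 1 \<and> \<beta> < \<beta>\<^sub>0 \<longrightarrow>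
       (\<forall>x y z. prox_inexact_ALM f A b l u \<Gamma> p c \<alpha> \<beta> x y z \<longrightarrow>
          bounded (range y) \<and>
          (\<lambda>t. norm (x (Suc t) - x t)) \<longlonglongrightarrow> 0 \<and>
          (\<lambda>t. infdist (x t) (stationary_points f A b l u)) \<longlonglongrightarrow> 0 \<and>
          (\<lambda>t. infdist (z t) (stationary_points f A b l u)) \<longlonglongrightarrow> 0 \<and>
          (\<lambda>t. infdist (x t, y t) (primal_dual_stationary_points f A b l u)) \<longlonglongrightarrow> 0 \<and>
          (\<forall>w r. strict_mono (r :: nat \<Rightarrow> nat) \<and> ((\<lambda>t. (x t, y t)) \<circ> r) \<longlonglongrightarrow> w \<longrightarrow>
             w \<in> primal_dual_stationary_points f A b l u))"
    if \<alpha>: "0 < \<alpha>" "\<alpha> < (1 / c - L\<^sub>K) / (2 * (S + 1))" for \<alpha>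
  proof -
    have "\<alpha> * (2 * (S + 1)) < 1 / c - L\<^sub>K"
      using \<alpha>(2) S by (simp add: pos_less_divide_eq)
    moreover have "\<alpha> * (2 * (S + 1)) = 2 * (\<alpha> * S) + 2 * \<alpha>" by (simp add: algebra_simps)
    moreover have "s \<le> k / 2" if "2 * s + 2 * \<alpha> < k" for s k using that \<alpha>(1) by linarith
    ultimately have \<alpha>S: "\<alpha> * S \<le> (1 / c - L\<^sub>K) / 2" by metis
    define E where "E = 8 * p * C\<^sup>2 / \<alpha> + 8 * (p / (p + \<gamma>))"
    have E: "0 < E" unfolding E_def using p_pos C(1) \<alpha>(1) m_pos by (intro add_pos_pos) auto
    show ?thesis
    proof (intro exI[of _ "1 / E"] conjI allI impI; (elim conjE)?)
      show "0 < 1 / E" using E by simp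
      fix \<beta> x y z
      assume \<beta>: "0 < \<beta>" "\<beta> \<le> 1" "\<beta> < 1 / E"
        and run: "prox_inexact_ALM f A b l u \<Gamma> p c \<alpha> \<beta> x y z"
      have "\<beta> * E \<le> 1" using \<beta>(3) E by (simp add: less_divide_eq)
      then interpret run: prox_alm_run f A b l u L \<gamma> \<Gamma> p c C D \<alpha> \<beta> x z y
        by unfold_locales (use C D_def \<alpha>(1) \<alpha>S \<beta> run in \<open>auto simp: S_def E_def\<close>)
      show "bounded (range y)" by (rule run.y_bounded)
      show "(\<lambda>t. norm (x (Suc t) - x t)) \<longlonglongrightarrow> 0"
        by (rule tendsto_norm_zero[OF run.dx_tendsto])
      show "(\<lambda>t. infdist (x t) (stationary_points f A b l u)) \<longlonglongrightarrow> 0"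
        "(\<lambda>t. infdist (z t) (stationary_points f A b l u)) \<longlonglongrightarrow> 0"
        "(\<lambda>t. infdist (x t, y t) (primal_dual_stationary_points f A b l u)) \<longlonglongrightarrow> 0"
        by (rule run.convergence)+
      fix w r assume r: "strict_mono (r :: nat \<Rightarrow> nat)" "((\<lambda>t. (x t, y t)) \<circ> r) \<longlonglongrightarrow> w"
      have "(fst w, snd w) \<in> primal_dual_stationary_points f A b l u"
        using tendsto_fst[OF r(2)] tendsto_snd[OF r(2)]
        by (intro run.limit_point_stationary[OF r(1)]) (simp_all add: o_def)
      then show "w \<in> primal_dual_stationary_points f A b l u" by simp
    qed
  qed
  ultimately show ?thesis by blast
qed

end
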